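(* The space $\mathcal R'(I)$ is isomorphic, as a topological linear space, to $\mathcal D'(I_* )$.
   Context: $I=(a,b)\subset\mathbf R$ is an open interval (e.g. $I=\mathbf R$), $\mathbf N_0=\mathbf N\cup\{0\}$; functions on $I$ are identified when equal almost everywhere. $\mathbb G=\mathbb G(I)$ is the Banach algebra (norm $\|\cdot\|_{L_\infty}$) of essentially bounded $g:I\to\mathbf C$ possessing both limits $g(t\pm)=\operatorname{ess\,lim}_{s\to t\pm}g(s)$ at every $t\in I$. $\mathbb G^\infty=\mathbb G^\infty(I)$ is the algebra of $g\in\mathbb G$ such that for every $k\in\mathbf N$ there is $g^{(k)}\in\mathbb G$ with $g^{(k)}(t\pm)=\operatorname{ess\,lim}_{s\to t\pm}\frac{g^{(k-1)}(s)-g^{(k-1)}(t\pm)}{s-t}$ for all $t\in I$ ($g^{(0)}=g$), with the norms $\|g\|_k=\max_{0\le i\le k}\|g^{(i)}\|_{L_\infty}$, $k\in\mathbf N_0$. $\mathcal R=\mathcal R(I)$ is the space of $\varphi\in\mathbb G^\infty$ with compact support in $I$, with the locally convex inductive limit topology of the countably normed spaces $\{\varphi\in\mathbb G^\infty:\varphi=0\text{ outside }J\}$ (norms $\|\cdot\|_k$), $J$ running over bounded subintervals with $\bar J\subset I$. $\mathcal R'=\mathcal R'(I)$ is the space of continuous linear functionals $\mathcal R\to\mathbf C$ with the weak* topology. $I_*$ is the space of the algebra homomorphisms $\mathbb G\to\mathbf C$ of the form $t-:g\mapsto g(t-)$ and $t+:g\mapsto g(t+)$, $t\in I$, with the weak*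 topology (topology of pointwise convergence on $\mathbb G$); put $[t+]=[t-]:=t$, and write $t\cdot$ for a generic point ($t+$ or $t-$). $\mathbb C(I_* )$ is the algebra of bounded continuous functions on $I_*$. $\mathbb C^\infty(I_* )$ is the algebra of $g\in\mathbb C(I_* )$ such that for every $k\in\mathbf N$ and $t\cdot\in I_*$ the limit $g^{(k)}(t\cdot)=\lim_{r\to t\cdot,\,r\ne t\cdot}\frac{g^{(k-1)}(r)-g^{(k-1)}(t\cdot)}{[r]-t}$ exists and $g^{(k)}\in\mathbb C(I_* )$ ($g^{(0)}:=g$), with the norms $\|g\|_k=\max_{0\le i\le k}\sup_{t\cdot\in I_*}|g^{(i)}(t\cdot)|$. $\mathcal D(I_* )$ is the space of $\varphi\in\mathbb C^\infty(I_* )$ for which there are $c,d\in I$ with $\varphi(t\cdot)=0$ whenever $t<c$ or $t>d$, with the convergence: $\varphi_k\to\varphi$ iff $\varphi_k\to\varphi$ in $\mathbb C^\infty(I_* )$ (in all norms $\|\cdot\|_j$) and there are $c,d\in I$ with $\varphi_k(t\cdot)=0$ for all $k$ whenever $t<c$ or $t>d$. $\mathcal D'(I_* )$ is the space of all linear functionals on $\mathcal D(I_* )$ continuous with respect to this convergence, with the weak* topology. *)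

theory Defs
  imports "HOL-Analysis.Analysis" "HOL-Probability.Essential_Supremum"
begin

section \<open>Complex topological linear spaces with an explicit carrier\<close>

text \<open>The carrier of a space is the \<^term>\<open>topspace\<close> of its topology; the linear operations are
  passed separately.\<close>

definition locally_convex_topology ::
  "'v set \<Rightarrow> ('v \<Rightarrow> 'v \<Rightarrow> 'v) \<Rightarrow> (complex \<Rightarrow> 'v \<Rightarrow> 'v) \<Rightarrow> 'v topology \<Rightarrow> bool"
  where
  "locally_convex_topology V vadd smul T \<longleftrightarrow>
     topspace T = V \<and>
     continuous_map (prod_topology T T) T (\<lambda>(x, y). vadd x y) \<and>
     continuous_map (prod_topology euclidean T) T (\<lambda>(c, x). smul c x) \<and>
     (\<forall>U x. openin T U \<and> x \<in> U \<longrightarrow>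
        (\<exists>W. openin T W \<and> x \<in> W \<and> W \<subseteq> U \<and>
           (\<forall>y\<in>W. \<forall>z\<in>W. \<forall>u\<in>{0..1::real}.
              vadd (smul (of_real (1 - u)) y) (smul (of_real u) z) \<in> W)))"

definition linear_functional_on ::
  "'v set \<Rightarrow> ('v \<Rightarrow> 'v \<Rightarrow> 'v) \<Rightarrow> (complex \<Rightarrow> 'v \<Rightarrow> 'v) \<Rightarrow> ('v \<Rightarrow> complex) \<Rightarrow> bool"
  where
  "linear_functional_on V vadd smul L \<longleftrightarrow>
     (\<forall>x\<in>V. \<forall>y\<in>V. L (vadd x y) = L x + L y) \<and>
     (\<forall>c. \<forall>x\<in>V. L (smul c x) = c * L x)"

definition tls_isomorphic ::
  "'v topology \<Rightarrow> ('v \<Rightarrow> 'v \<Rightarrow> 'v) \<Rightarrow> (complex \<Rightarrow> 'v \<Rightarrow> 'v) \<Rightarrow>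
   'w topology \<Rightarrow> ('w \<Rightarrow> 'w \<Rightarrow> 'w) \<Rightarrow> (complex \<Rightarrow> 'w \<Rightarrow> 'w) \<Rightarrow> bool"
  where
  "tls_isomorphic X addX scaleX Y addY scaleY \<longleftrightarrow>
     (\<exists>\<Phi>. homeomorphic_map X Y \<Phi> \<and>
        (\<forall>x\<in>topspace X. \<forall>y\<in>topspace X. \<Phi> (addX x y) = addY (\<Phi> x) (\<Phi> y)) \<and>
        (\<forall>c. \<forall>x\<in>topspace X. \<Phi> (scaleX c x) = scaleY c (\<Phi> x)))"

text \<open>Functions on a set \<open>S\<close> are represented by elements of \<^term>\<open>extensional S\<close>, with the pointwise
  operations below. The weak* topology on a set of functionals on \<open>V\<close> is the topology of pointwise
  convergence on \<open>V\<close>.\<close>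

definition pw_add :: "'s set \<Rightarrow> ('s \<Rightarrow> complex) \<Rightarrow> ('s \<Rightarrow> complex) \<Rightarrow> 's \<Rightarrow> complex" where
  "pw_add S f g = (\<lambda>s\<in>S. f s + g s)"

definition pw_diff :: "'s set \<Rightarrow> ('s \<Rightarrow> complex) \<Rightarrow> ('s \<Rightarrow> complex) \<Rightarrow> 's \<Rightarrow> complex" where
  "pw_diff S f g = (\<lambda>s\<in>S. f s - g s)"

definition pw_scale :: "'s set \<Rightarrow> complex \<Rightarrow> ('s \<Rightarrow> complex) \<Rightarrow> 's \<Rightarrow> complex" where
  "pw_scale S c f = (\<lambda>s\<in>S. c * f s)"

definition pointwise_topology :: "'v set \<Rightarrow> ('v \<Rightarrow> complex) set \<Rightarrow> ('v \<Rightarrow> complex) topology" where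
  "pointwise_topology V F = subtopology (product_topology (\<lambda>_. euclidean) V) F"


section \<open>The algebra \<open>G(I)\<close>\<close>

text \<open>Functions on \<open>I\<close> are total functions considered up to equality almost everywhere on \<open>I\<close>; the
  elements of \<open>G(I)\<close> are the resulting equivalence classes. Quantities attached to a class are
  computed on an arbitrary representative, on which they do not depend.\<close>

type_synonym fclass = "(real \<Rightarrow> complex) set"

definition ae_rel :: "real set \<Rightarrow> ((real \<Rightarrow> complex) \<times> (real \<Rightarrow> complex)) set" where
  "ae_rel I = {(f, g). AE t in lebesgue_on I. f t = g t}"

definition ae_class :: "real set \<Rightarrow> (real \<Rightarrow> complex) \<Rightarrow> fclass" where
  "ae_class I f = ae_rel I `` {f}"

definition rep :: "fclass \<Rightarrow> real \<Rightarrow> complex" where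
  "rep X = (SOME f. f \<in> X)"

definition cl_add :: "real set \<Rightarrow> fclass \<Rightarrow> fclass \<Rightarrow> fclass" where
  "cl_add I X Y = ae_class I (\<lambda>t. rep X t + rep Y t)"

definition cl_diff :: "real set \<Rightarrow> fclass \<Rightarrow> fclass \<Rightarrow> fclass" where
  "cl_diff I X Y = ae_class I (\<lambda>t. rep X t - rep Y t)"

definition cl_scale :: "real set \<Rightarrow> complex \<Rightarrow> fclass \<Rightarrow> fclass" where
  "cl_scale I c X = ae_class I (\<lambda>t. c * rep X t)"

text \<open>A property holds eventually along \<open>ess_at_right t\<close> iff it holds for almost every
  \<open>s \<in> (t, t + \<delta>)\<close>, for some \<open>\<delta> > 0\<close>; limits along this filter are the one-sided essential limits.\<close>

definition ess_at_right :: "real \<Rightarrow> real filter" where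
  "ess_at_right t = inf (at_right t) (ae_filter lebesgue)"

definition ess_at_left :: "real \<Rightarrow> real filter" where
  "ess_at_left t = inf (at_left t) (ae_filter lebesgue)"

definition G_fun :: "real set \<Rightarrow> (real \<Rightarrow> complex) set" where
  "G_fun I = {g. g \<in> borel_measurable (lebesgue_on I) \<and>
      (\<exists>C. AE t in lebesgue_on I. cmod (g t) \<le> C) \<and>
      (\<forall>t\<in>I. (\<exists>l. (g \<longlongrightarrow> l) (ess_at_right t)) \<and> (\<exists>l. (g \<longlongrightarrow> l) (ess_at_left t)))}"

definition G_space :: "real set \<Rightarrow> fclass set" where
  "G_space I = G_fun I // ae_rel I"

definition rlim :: "fclass \<Rightarrow> real \<Rightarrow> complex" where
  "rlim X t = Lim (ess_at_right t) (rep X)"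

definition llim :: "fclass \<Rightarrow> real \<Rightarrow> complex" where
  "llim X t = Lim (ess_at_left t) (rep X)"

definition Linf_norm :: "real set \<Rightarrow> fclass \<Rightarrow> real" where
  "Linf_norm I X = real_of_ereal (esssup (lebesgue_on I) (\<lambda>t. ereal (cmod (rep X t))))"


section \<open>The algebra \<open>G\<^sup>\<infinity>(I)\<close>\<close>

definition has_G_deriv :: "real set \<Rightarrow> fclass \<Rightarrow> fclass \<Rightarrow> bool" where
  "has_G_deriv I X Y \<longleftrightarrow> Y \<in> G_space I \<and>
     (\<forall>t\<in>I.
        ((\<lambda>s. (rep X s - rlim X t) / of_real (s - t)) \<longlongrightarrow> rlim Y t) (ess_at_right t) \<and>
        ((\<lambda>s. (rep X s - llim X t) / of_real (s - t)) \<longlongrightarrow> llim Y t) (ess_at_left t))"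

text \<open>An element of \<open>G(I)\<close> is determined by its one-sided limits, so the derivative is unique.\<close>

definition G_deriv :: "real set \<Rightarrow> fclass \<Rightarrow> fclass" where
  "G_deriv I X = (THE Y. has_G_deriv I X Y)"

definition G_inf :: "real set \<Rightarrow> fclass set" where
  "G_inf I = {X \<in> G_space I. \<forall>k. \<exists>Y. has_G_deriv I ((G_deriv I ^^ k) X) Y}"

definition G_norm :: "real set \<Rightarrow> nat \<Rightarrow> fclass \<Rightarrow> real" where
  "G_norm I k X = Max ((\<lambda>i. Linf_norm I ((G_deriv I ^^ i) X)) ` {..k})"


section \<open>The space \<open>R(I)\<close> and its dual\<close>

definition vanishes_off :: "real set \<Rightarrow> real set \<Rightarrow> fclass \<Rightarrow> bool" where
  "vanishes_off I J X \<longleftrightarrow> (AE t in lebesgue_on I. t \<notin> J \<longrightarrow> rep X t = 0)"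

definition R_space :: "real set \<Rightarrow> fclass set" where
  "R_space I = {X \<in> G_inf I. \<exists>K. compact K \<and> K \<subseteq> I \<and> vanishes_off I K X}"

definition inner_intervals :: "real set \<Rightarrow> real set set" where
  "inner_intervals I = {J. is_interval J \<and> bounded J \<and> closure J \<subseteq> I}"

definition R_step :: "real set \<Rightarrow> real set \<Rightarrow> fclass set" where
  "R_step I J = {X \<in> G_inf I. vanishes_off I J X}"

definition R_step_topology :: "real set \<Rightarrow> real set \<Rightarrow> fclass topology" where
  "R_step_topology I J = topology_generated_by
     {{Y \<in> R_step I J. G_norm I k (cl_diff I Y X) < e} | X k e. X \<in> R_step I J \<and> e > 0}"

text \<open>The locally convex inductive limit topology is the finest locally convex topology for which all
  inclusions of the steps are continuous, that is, the supremum of all locally convex topologies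
  with this property.\<close>

definition R_topology :: "real set \<Rightarrow> fclass topology" where
  "R_topology I = topology_generated_by
     {U. \<exists>T. locally_convex_topology (R_space I) (cl_add I) (cl_scale I) T \<and>
          (\<forall>J\<in>inner_intervals I. continuous_map (R_step_topology I J) T (\<lambda>X. X)) \<and>
          openin T U}"

definition R_dual :: "real set \<Rightarrow> (fclass \<Rightarrow> complex) set" where
  "R_dual I = {L \<in> extensional (R_space I).
      linear_functional_on (R_space I) (cl_add I) (cl_scale I) L \<and>
      continuous_map (R_topology I) euclidean L}"

definition R_dual_topology :: "real set \<Rightarrow> (fclass \<Rightarrow> complex) topology" where
  "R_dual_topology I = pointwise_topology (R_space I) (R_dual I)"


section \<open>The space \<open>I\<^sub>*\<close> and the algebra \<open>C\<^sup>\<infinity>(I\<^sub>*)\<close>\<close>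

type_synonym gpoint = "fclass \<Rightarrow> complex"

definition pt_right :: "real set \<Rightarrow> real \<Rightarrow> gpoint" where
  "pt_right I t = (\<lambda>X\<in>G_space I. rlim X t)"

definition pt_left :: "real set \<Rightarrow> real \<Rightarrow> gpoint" where
  "pt_left I t = (\<lambda>X\<in>G_space I. llim X t)"

definition Istar :: "real set \<Rightarrow> gpoint set" where
  "Istar I = pt_left I ` I \<union> pt_right I ` I"

definition Istar_topology :: "real set \<Rightarrow> gpoint topology" where
  "Istar_topology I = pointwise_topology (G_space I) (Istar I)"

definition base_pt :: "real set \<Rightarrow> gpoint \<Rightarrow> real" where
  "base_pt I p = (THE t. t \<in> I \<and> (p = pt_left I t \<or> p = pt_right I t))"

definition C_star :: "real set \<Rightarrow> (gpoint \<Rightarrow> complex) set" where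
  "C_star I = {g \<in> extensional (Istar I).
      continuous_map (Istar_topology I) euclidean g \<and> bounded (g ` Istar I)}"

definition has_star_deriv_at ::
  "real set \<Rightarrow> (gpoint \<Rightarrow> complex) \<Rightarrow> gpoint \<Rightarrow> complex \<Rightarrow> bool" where
  "has_star_deriv_at I g p l \<longleftrightarrow>
     ((\<lambda>r. (g r - g p) / of_real (base_pt I r - base_pt I p)) \<longlongrightarrow> l) (atin (Istar_topology I) p)"

definition star_deriv :: "real set \<Rightarrow> (gpoint \<Rightarrow> complex) \<Rightarrow> gpoint \<Rightarrow> complex" where
  "star_deriv I g = (\<lambda>p\<in>Istar I. THE l. has_star_deriv_at I g p l)"

definition C_star_inf :: "real set \<Rightarrow> (gpoint \<Rightarrow> complex) set" where
  "C_star_inf I = {g \<in> C_star I. \<forall>k.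
      (\<forall>p\<in>Istar I. \<exists>l. has_star_deriv_at I ((star_deriv I ^^ k) g) p l) \<and>
      (star_deriv I ^^ Suc k) g \<in> C_star I}"

definition star_norm :: "real set \<Rightarrow> nat \<Rightarrow> (gpoint \<Rightarrow> complex) \<Rightarrow> real" where
  "star_norm I k g = Max ((\<lambda>i. SUP p\<in>Istar I. cmod ((star_deriv I ^^ i) g p)) ` {..k})"


section \<open>The space \<open>D(I\<^sub>*)\<close> and its dual\<close>

definition star_vanishes_off :: "real set \<Rightarrow> real \<Rightarrow> real \<Rightarrow> (gpoint \<Rightarrow> complex) \<Rightarrow> bool" where
  "star_vanishes_off I c d \<phi> \<longleftrightarrow>
     (\<forall>p\<in>Istar I. base_pt I p < c \<or> base_pt I p > d \<longrightarrow> \<phi> p = 0)"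

definition D_star :: "real set \<Rightarrow> (gpoint \<Rightarrow> complex) set" where
  "D_star I = {\<phi> \<in> C_star_inf I. \<exists>c\<in>I. \<exists>d\<in>I. star_vanishes_off I c d \<phi>}"

definition D_star_conv ::
  "real set \<Rightarrow> (nat \<Rightarrow> gpoint \<Rightarrow> complex) \<Rightarrow> (gpoint \<Rightarrow> complex) \<Rightarrow> bool" where
  "D_star_conv I \<phi>s \<phi> \<longleftrightarrow>
     (\<forall>n. \<phi>s n \<in> D_star I) \<and> \<phi> \<in> D_star I \<and>
     (\<forall>j. (\<lambda>n. star_norm I j (pw_diff (Istar I) (\<phi>s n) \<phi>)) \<longlonglongrightarrow> 0) \<and>
     (\<exists>c\<in>I. \<exists>d\<in>I. \<forall>n. star_vanishes_off I c d (\<phi>s n))"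

definition D_star_dual :: "real set \<Rightarrow> ((gpoint \<Rightarrow> complex) \<Rightarrow> complex) set" where
  "D_star_dual I = {L \<in> extensional (D_star I).
      linear_functional_on (D_star I) (pw_add (Istar I)) (pw_scale (Istar I)) L \<and>
      (\<forall>\<phi>s \<phi>. D_star_conv I \<phi>s \<phi> \<longrightarrow> (\<lambda>n. L (\<phi>s n)) \<longlonglongrightarrow> L \<phi>)}"

definition D_star_dual_topology :: "real set \<Rightarrow> ((gpoint \<Rightarrow> complex) \<Rightarrow> complex) topology" where
  "D_star_dual_topology I = pointwise_topology (D_star I) (D_star_dual I)"

end

theory Submission
  imports Defs
begin

text \<open>
  Every class \<open>X\<close> in \<open>G(I)\<close> defines a function \<open>p \<mapsto> p X\<close> on \<open>I\<^sub>*\<close>. A punctured neighbourhood base of \<open>t+\<close>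
  consists of the sets of all \<open>s-\<close>, \<open>s+\<close> with \<open>t < s < t + \<delta>\<close>, so this function is continuous. Since a class
  agrees almost everywhere with its right limits (a Lindelof argument), it is determined by that
  function, with the same supremum norm; conversely a continuous \<open>g\<close> on \<open>I\<^sub>*\<close> comes from the
  right-continuous function \<open>t \<mapsto> g (t+)\<close>. Under this bijection an essential limit of difference
  quotients is the same as their limit in \<open>I\<^sub>*\<close>, so derivatives, norms and supports correspond and
  \<open>R(I)\<close> is mapped linearly onto \<open>D(I\<^sub>*)\<close>. A linear functional on the inductive limit is continuous iff
  it is continuous on every step, and on the countably normed steps this is sequential continuity,
  that is, continuity for the convergence of \<open>D(I\<^sub>*)\<close>. Transposition gives the isomorphism of the duals.
\<close>

section \<open>One-sided essential limits\<close>

text \<open>A class has no values at points, only essential limits, whereas a function on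
  \<open>I_*\<close> has values and ordinary limits. \<open>slim\<close> mediates: it gives every
  class a value at each point of \<open>I\<close> from either side, and closed conditions that hold
  almost everywhere for \<open>rep X\<close> pass to it. Hence the recurring weakening of
  \<open><\<close> to \<le> and the halved radii. A limit at \<open>t+\<close> in \<open>I_*\<close>
  runs over \<open>s-\<close> and \<open>s+\<close> together, so each limit there is a statement
  about both flags \<open>q\<close> at once. \<open>D_star I\<close> carries no topology, only a
  notion of convergent sequences, so \<open>hat\<close> is never claimed to be a homeomorphism of
  the test spaces. What is needed is a linear bijection under which the continuous functionals of
  the two sides correspond. The weak* topologies then match by themselves, since they only see
  evaluation at single test functions.\<close>

text \<open>The Boolean flag selects the right (\<^term>\<open>True\<close>) or the left (\<^term>\<open>False\<close>) side, so that
  both cases are treated at once.\<close>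

definition side :: "bool \<Rightarrow> real \<Rightarrow> real \<Rightarrow> real set" where
  "side r t d = (if r then {t<..<t + d} else {t - d<..<t})"

definition ess_at :: "bool \<Rightarrow> real \<Rightarrow> real filter" where
  "ess_at r t = (if r then ess_at_right t else ess_at_left t)"

definition slim :: "bool \<Rightarrow> fclass \<Rightarrow> real \<Rightarrow> complex" where
  "slim r X t = (if r then rlim X t else llim X t)"

lemma slim_eq_Lim: "slim r X t = Lim (ess_at r t) (rep X)"
  by (simp add: slim_def ess_at_def rlim_def llim_def)

lemma open_side: "open (side r t d)"
  by (simp add: side_def)

lemma side_mono: "d \<le> e \<Longrightarrow> side r t d \<subseteq> side r t e"
  by (auto simp: side_def)

lemma not_in_side: "t \<notin> side r t d"
  by (simp add: side_def)

lemma side_subset_ball: "side r t d \<subseteq> ball t d"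
  by (auto simp: side_def dist_real_def)

lemma side_nonempty:
  assumes "d > 0"
  obtains s where "s \<in> side r t d"
proof
  show "(if r then t + d / 2 else t - d / 2) \<in> side r t d"
    using assms by (simp add: side_def)
qed

lemma ball_eq_sides: "ball t d \<subseteq> insert t (side True t d \<union> side False t d)"
  by (auto simp: side_def dist_real_def split: if_splits)

lemma side_in_open:
  assumes "open U" "t \<in> U"
  obtains d where "d > 0" "side r t d \<subseteq> U"
proof -
  obtain d where "d > 0" "ball t d \<subseteq> U"
    using assms openE by blast
  then show thesis
    using that[of d] side_subset_ball[of r t d] by auto
qed

text \<open>Functions on \<open>I_*\<close> are defined everywhere, so their limits run along this
  ordinary one-sided filter. Representatives of classes have limits only along the smaller filter
  \<open>ess_at\<close>.\<close>

definition at_side :: "bool \<Rightarrow> real \<Rightarrow> real filter" where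
  "at_side r t = (if r then at_right t else at_left t)"

lemma eventually_at_side:
  "eventually Q (at_side r t) \<longleftrightarrow> (\<exists>d>0. \<forall>s\<in>side r t d. Q s)"
proof -
  have right: "eventually Q (at_right t) \<longleftrightarrow> (\<exists>d>0. \<forall>s\<in>side True t d. Q s)"
  proof
    assume "eventually Q (at_right t)"
    then obtain b where "b > t" "\<forall>y>t. y < b \<longrightarrow> Q y"
      unfolding eventually_at_right_field by blast
    then show "\<exists>d>0. \<forall>s\<in>side True t d. Q s"
      by (intro exI[of _ "b - t"]) (simp add: side_def)
  next
    assume "\<exists>d>0. \<forall>s\<in>side True t d. Q s"
    then obtain d where "d > 0" "\<forall>s\<in>side True t d. Q s"
      by blast
    then show "eventually Q (at_right t)"
      unfolding eventually_at_right_field by (intro exI[of _ "t + d"]) (simp add: side_def)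
  qed
  have left: "eventually Q (at_left t) \<longleftrightarrow> (\<exists>d>0. \<forall>s\<in>side False t d. Q s)"
  proof
    assume "eventually Q (at_left t)"
    then obtain b where "b < t" "\<forall>y>b. y < t \<longrightarrow> Q y"
      unfolding eventually_at_left_field by blast
    then show "\<exists>d>0. \<forall>s\<in>side False t d. Q s"
      by (intro exI[of _ "t - b"]) (simp add: side_def)
  next
    assume "\<exists>d>0. \<forall>s\<in>side False t d. Q s"
    then obtain d where "d > 0" "\<forall>s\<in>side False t d. Q s"
      by blast
    then show "eventually Q (at_left t)"
      unfolding eventually_at_left_field by (intro exI[of _ "t - d"]) (simp add: side_def)
  qed
  show ?thesis
    using left right by (cases r) (simp_all add: at_side_def)
qed

lemma ess_at_eq: "ess_at r t = inf (at_side r t) (ae_filter lebesgue)"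
  by (simp add: ess_at_def at_side_def ess_at_right_def ess_at_left_def)

lemma ess_at_le: "ess_at r t \<le> at_side r t"
  by (simp add: ess_at_eq)

lemma at_side_neq_bot: "at_side r t \<noteq> bot"
  by (simp add: at_side_def trivial_limit_at_right_real trivial_limit_at_left_real)

lemma at_side_le_at: "at_side r t \<le> at t"
  by (simp add: at_side_def at_le)

lemma eventually_at_side_mem:
  assumes "open U" "t \<in> U"
  shows "eventually (\<lambda>s. s \<in> U) (at_side r t)"
proof -
  obtain d where "d > 0" "side r t d \<subseteq> U"
    by (rule side_in_open[OF assms])
  then show ?thesis
    by (auto simp: eventually_at_side)
qed

lemma eventually_ess_at:
  "eventually P (ess_at r t) \<longleftrightarrow> (\<exists>d>0. AE s in lebesgue. s \<in> side r t d \<longrightarrow> P s)"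
proof
  assume "eventually P (ess_at r t)"
  then obtain Q R where "eventually Q (at_side r t)" "eventually R (ae_filter lebesgue)"
    and QR: "\<And>s. Q s \<Longrightarrow> R s \<Longrightarrow> P s"
    unfolding ess_at_eq eventually_inf by blast
  then obtain d where "d > 0" "\<And>s. s \<in> side r t d \<Longrightarrow> Q s"
    unfolding eventually_at_side by blast
  have "AE s in lebesgue. s \<in> side r t d \<longrightarrow> P s"
    using \<open>eventually R _\<close> by (rule eventually_mono) (simp add: QR \<open>\<And>s. s \<in> side r t d \<Longrightarrow> Q s\<close>)
  with \<open>d > 0\<close> show "\<exists>d>0. AE s in lebesgue. s \<in> side r t d \<longrightarrow> P s"
    by (intro exI conjI)
next
  assume "\<exists>d>0. AE s in lebesgue. s \<in> side r t d \<longrightarrow> P s"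
  then obtain d where "d > 0" "AE s in lebesgue. s \<in> side r t d \<longrightarrow> P s"
    by blast
  moreover have "eventually (\<lambda>s. s \<in> side r t d) (at_side r t)"
    using \<open>d > 0\<close> by (auto simp: eventually_at_side)
  ultimately show "eventually P (ess_at r t)"
    unfolding ess_at_eq eventually_inf
    by (intro exI[of _ "\<lambda>s. s \<in> side r t d"] exI[of _ "\<lambda>s. s \<in> side r t d \<longrightarrow> P s"]) simp
qed

text \<open>A nonempty open set is not a null set, so it cannot consist of exceptional points
  alone.\<close>

lemma AE_lebesgue_open_ex:
  assumes "AE s in lebesgue. s \<in> U \<longrightarrow> P s" "open U" "U \<noteq> {}"
  shows "\<exists>s::real\<in>U. P s"
proof (rule ccontr)
  assume "\<not> ?thesis"
  then have "AE s in lebesgue. s \<notin> U"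
    using assms(1) by (auto elim!: eventually_mono)
  then have "U \<in> null_sets lebesgue"
    by (simp add: AE_iff_null_sets assms borel_open lborelD)
  then show False
    using assms negligible_iff_null_sets open_not_negligible by blast
qed

text \<open>Essential limits are therefore unique, which lets \<open>Lim\<close> in
  \<open>slim\<close> return the limit whenever one exists.\<close>

lemma ess_at_neq_bot: "ess_at r t \<noteq> bot"
proof
  assume "ess_at r t = bot"
  then have "eventually (\<lambda>_. False) (ess_at r t)"
    by simp
  then obtain d where "d > 0" "AE s in lebesgue. s \<in> side r t d \<longrightarrow> False"
    unfolding eventually_ess_at by blast
  moreover have "side r t d \<noteq> {}"
    using side_nonempty[OF \<open>d > 0\<close>, of r t] by auto
  ultimately show False
    using AE_lebesgue_open_ex[OF _ open_side, of r t d "\<lambda>_. False"] by simp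
qed

text \<open>The exceptional null sets are indexed by uncountably many \<open>t\<close>; Lindelof
  leaves countably many. A ball consists of its two sides and its centre, and the centre is a null
  set.\<close>

lemma AE_from_local:
  assumes "\<And>t. t \<in> I \<Longrightarrow> \<exists>d>0. \<forall>r. AE s in lebesgue. s \<in> side r t d \<longrightarrow> P s"
  shows "AE s in lebesgue. s \<in> I \<longrightarrow> P s"
proof -
  obtain d where d: "\<And>t. t \<in> I \<Longrightarrow> d t > 0"
    "\<And>t r. t \<in> I \<Longrightarrow> AE s in lebesgue. s \<in> side r t (d t) \<longrightarrow> P s"
    using assms by metis
  obtain \<F> where \<F>: "\<F> \<subseteq> (\<lambda>t. ball t (d t)) ` I" "countable \<F>"
    "\<Union>\<F> = (\<Union>t\<in>I. ball t (d t))"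
    by (rule Lindelof[of "(\<lambda>t. ball t (d t)) ` I"]) auto
  have "AE s in lebesgue. \<forall>B\<in>\<F>. s \<in> B \<longrightarrow> P s"
  proof (subst AE_ball_countable[OF \<F>(2)], intro ballI)
    fix B assume "B \<in> \<F>"
    then obtain t where t: "t \<in> I" "B = ball t (d t)"
      using \<F>(1) by blast
    have "AE s in lebesgue. s \<noteq> t"
      using AE_not_in[of "{t}" lebesgue] negligible_sing[of t]
      by (simp add: negligible_iff_null_sets)
    with d(2)[OF t(1), of True] d(2)[OF t(1), of False]
    show "AE s in lebesgue. s \<in> B \<longrightarrow> P s"
    proof eventually_elim
      case (elim s)
      then show ?case
        using ball_eq_sides[of t "d t"] t by blast
    qed
  qed
  then show ?thesis
  proof (rule eventually_mono, intro impI)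
    fix s assume "\<forall>B\<in>\<F>. s \<in> B \<longrightarrow> P s" "s \<in> I"
    moreover have "s \<in> \<Union>\<F>"
      unfolding \<F>(3) using d(1) \<open>s \<in> I\<close> by (intro UN_I[of s]) auto
    ultimately show "P s"
      by blast
  qed
qed

text \<open>Seen from \<open>u+\<close> and from \<open>v-\<close> the indicator is 1, seen from
  \<open>u-\<close> and from \<open>v+\<close> it is 0; hence the half-open conditions. These
  functions later separate the points of \<open>I_*\<close>.\<close>

lemma tendsto_indicator_ess_at:
  fixes u v :: real
  assumes "u < v"
  shows "((\<lambda>s. if u < s \<and> s < v then 1 else 0 :: complex) \<longlongrightarrow>
    (if (if r then u \<le> t \<and> t < v else u < t \<and> t \<le> v) then 1 else 0)) (ess_at r t)"
proof (rule tendsto_eventually)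
  have "\<exists>d>0. \<forall>s\<in>side r t d. (u < s \<and> s < v) = (if r then u \<le> t \<and> t < v else u < t \<and> t \<le> v)"
  proof (cases r)
    case True
    \<comment> \<open>The indicator is constant up to the next endpoint on the chosen side of
      \<open>t\<close>; if no endpoint is left on that side, any length will do.\<close>
    let ?d = "if t < u then u - t else if t < v then v - t else 1"
    show ?thesis
      using True assms by (intro exI[of _ ?d]) (auto simp: side_def)
  next
    case False
    let ?d = "if t > v then t - v else if t > u then t - u else 1"
    show ?thesis
      using False assms by (intro exI[of _ ?d]) (auto simp: side_def)
  qed
  then obtain d where "d > 0" "\<forall>s\<in>side r t d. (u < s \<and> s < v) = (if r then u \<le> t \<and> t < v else u < t \<and> t \<le> v)"
    by blast
  then show "eventually (\<lambda>s. (if u < s \<and> s < v then 1 else 0) =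
      (if (if r then u \<le> t \<and> t < v else u < t \<and> t \<le> v) then 1 else (0::complex))) (ess_at r t)"
    unfolding eventually_ess_at by (intro exI[of _ d]) auto
qed

section \<open>Classes in \<open>G(I)\<close> and their one-sided limits\<close>

lemma ae_class_eq_iff: "ae_class I f = ae_class I g \<longleftrightarrow> (AE t in lebesgue_on I. f t = g t)"
proof
  assume "ae_class I f = ae_class I g"
  moreover have "g \<in> ae_class I g"
    by (simp add: ae_class_def ae_rel_def)
  ultimately show "AE t in lebesgue_on I. f t = g t"
    by (simp add: ae_class_def ae_rel_def set_eq_iff)
next
  assume *: "AE t in lebesgue_on I. f t = g t"
  have "(AE t in lebesgue_on I. f t = h t) \<longleftrightarrow> (AE t in lebesgue_on I. g t = h t)" for h
  proof
    assume "AE t in lebesgue_on I. f t = h t"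
    with * show "AE t in lebesgue_on I. g t = h t"
      by eventually_elim simp
  next
    assume "AE t in lebesgue_on I. g t = h t"
    with * show "AE t in lebesgue_on I. f t = h t"
      by eventually_elim simp
  qed
  then show "ae_class I f = ae_class I g"
    by (simp add: ae_class_def ae_rel_def set_eq_iff)
qed

lemma AE_rep_ae_class: "AE t in lebesgue_on I. rep (ae_class I f) t = f t"
proof -
  have "f \<in> ae_class I f"
    by (simp add: ae_class_def ae_rel_def)
  then have "rep (ae_class I f) \<in> ae_class I f"
    unfolding rep_def by (rule someI[where P = "\<lambda>g. g \<in> ae_class I f"])
  then have "AE t in lebesgue_on I. f t = rep (ae_class I f) t"
    by (simp add: ae_class_def ae_rel_def)
  then show ?thesis
    by eventually_elim simp
qed

lemma G_space_eq: "G_space I = ae_class I ` G_fun I"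
  by (auto simp: G_space_def quotient_def ae_class_def)

lemma ae_class_in_G_space: "f \<in> G_fun I \<Longrightarrow> ae_class I f \<in> G_space I"
  by (simp add: G_space_eq)

locale open_interval =
  fixes I :: "real set"
  assumes open_I: "open I" and interval_I: "is_interval I" and nonempty_I: "I \<noteq> {}"
begin

lemma AE_on_iff: "(AE t in lebesgue_on I. P t) \<longleftrightarrow> (AE t in lebesgue. t \<in> I \<longrightarrow> P t)"
  by (rule AE_restrict_space_iff) (simp add: open_I borel_open)

lemma eventually_ess_at_AE:
  assumes "AE t in lebesgue_on I. P t" "t \<in> I"
  shows "eventually P (ess_at r t)"
proof -
  obtain d where "d > 0" "side r t d \<subseteq> I"
    by (rule side_in_open[OF open_I \<open>t \<in> I\<close>])
  moreover have "AE s in lebesgue. s \<in> I \<longrightarrow> P s"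
    using assms(1) by (simp add: AE_on_iff)
  ultimately have "AE s in lebesgue. s \<in> side r t d \<longrightarrow> P s"
    by (auto elim!: eventually_mono)
  with \<open>d > 0\<close> show ?thesis
    unfolding eventually_ess_at by (intro exI conjI)
qed

lemma G_funI:
  assumes "g \<in> borel_measurable (lebesgue_on I)" "AE t in lebesgue_on I. cmod (g t) \<le> C"
    and "\<And>r t. t \<in> I \<Longrightarrow> (g \<longlongrightarrow> l r t) (ess_at r t)"
  shows "g \<in> G_fun I"
proof -
  have "(g \<longlongrightarrow> l True t) (ess_at_right t)" "(g \<longlongrightarrow> l False t) (ess_at_left t)" if "t \<in> I" for t
    using assms(3)[OF that, of True] assms(3)[OF that, of False] by (simp_all add: ess_at_def)
  then show ?thesis
    using assms(1,2) unfolding G_fun_def by blast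
qed

lemma G_fun_limit:
  assumes "g \<in> G_fun I" "t \<in> I"
  shows "\<exists>l. (g \<longlongrightarrow> l) (ess_at r t)"
  using assms by (auto simp: G_fun_def ess_at_def)

text \<open>Rests on completeness of Lebesgue measure; extension by 0 moves the question from
  \<open>lebesgue_on I\<close> to \<open>lebesgue\<close>.\<close>

lemma borel_measurable_AE_on:
  fixes f g :: "real \<Rightarrow> complex"
  assumes "f \<in> borel_measurable (lebesgue_on I)" "AE t in lebesgue_on I. f t = g t"
  shows "g \<in> borel_measurable (lebesgue_on I)"
proof -
  have I: "I \<in> sets lebesgue"
    by (simp add: open_I borel_open)
  have "(\<lambda>x. if x \<in> I then f x else 0) \<in> borel_measurable lebesgue"
    using assms(1) by (simp add: borel_measurable_if[OF I])
  moreover have "AE x in lebesgue. (if x \<in> I then f x else 0) = (if x \<in> I then g x else 0)"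
    using assms(2) unfolding AE_on_iff by eventually_elim simp
  ultimately have "(\<lambda>x. if x \<in> I then g x else 0) \<in> borel_measurable lebesgue"
    by (rule borel_measurable_AE)
  then show ?thesis
    by (simp add: borel_measurable_if[OF I])
qed

text \<open>\<open>rep\<close> picks an arbitrary member of a class, so membership in
  \<open>G_fun\<close> has to hold for all members as soon as it holds for one.\<close>

lemma G_fun_cong_AE:
  assumes f: "f \<in> G_fun I" and fg: "AE t in lebesgue_on I. f t = g t"
  shows "g \<in> G_fun I"
proof -
  define l where "l r t = Lim (ess_at r t) f" for r t
  have l: "(f \<longlongrightarrow> l r t) (ess_at r t)" if "t \<in> I" for r t
    using G_fun_limit[OF f that, of r] tendsto_Lim[OF ess_at_neq_bot, of f _ r t] by (auto simp: l_def)
  obtain C where C: "AE t in lebesgue_on I. cmod (f t) \<le> C"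
    using f by (auto simp: G_fun_def)
  show ?thesis
  proof (rule G_funI)
    show "g \<in> borel_measurable (lebesgue_on I)"
      using borel_measurable_AE_on[OF _ fg] f by (simp add: G_fun_def)
    show "AE t in lebesgue_on I. cmod (g t) \<le> C"
      using C fg by eventually_elim simp
    fix r t assume "t \<in> I"
    show "(g \<longlongrightarrow> l r t) (ess_at r t)"
      using l[OF \<open>t \<in> I\<close>] eventually_ess_at_AE[OF fg \<open>t \<in> I\<close>]
      by (rule Lim_transform_eventually)
  qed
qed

lemma
  assumes "X \<in> G_space I"
  shows rep_in_G_fun: "rep X \<in> G_fun I" and ae_class_rep: "ae_class I (rep X) = X"
proof -
  obtain f where f: "f \<in> G_fun I" "X = ae_class I f"
    using assms by (auto simp: G_space_eq)
  have "AE t in lebesgue_on I. f t = rep X t"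
    using AE_rep_ae_class[of I f] f(2) by (auto elim: eventually_mono)
  then show "rep X \<in> G_fun I" "ae_class I (rep X) = X"
    using f G_fun_cong_AE ae_class_eq_iff[of I f "rep X"] by auto
qed

lemma rep_tendsto_slim:
  assumes "X \<in> G_space I" "t \<in> I"
  shows "(rep X \<longlongrightarrow> slim r X t) (ess_at r t)"
  using G_fun_limit[OF rep_in_G_fun[OF assms(1)] assms(2), of r]
    tendsto_Lim[OF ess_at_neq_bot] by (auto simp: slim_eq_Lim)

lemma slim_eqI: "(rep X \<longlongrightarrow> l) (ess_at r t) \<Longrightarrow> slim r X t = l"
  by (simp add: slim_eq_Lim tendsto_Lim[OF ess_at_neq_bot])

lemma slim_ae_class:
  assumes "(f \<longlongrightarrow> l) (ess_at r t)" "t \<in> I"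
  shows "slim r (ae_class I f) t = l"
proof (rule slim_eqI)
  have "eventually (\<lambda>s. f s = rep (ae_class I f) s) (ess_at r t)"
    using eventually_ess_at_AE[OF AE_rep_ae_class[of I f] \<open>t \<in> I\<close>] by (rule eventually_mono) simp
  with assms(1) show "(rep (ae_class I f) \<longlongrightarrow> l) (ess_at r t)"
    by (rule Lim_transform_eventually)
qed

text \<open>The usual route by which an almost-everywhere statement about \<open>rep X\<close>
  becomes a statement about \<open>slim\<close> at every point.\<close>

lemma tendsto_ess_at_in_closed:
  assumes "(f \<longlongrightarrow> l) (ess_at r t)" "closed C" "AE s in lebesgue. s \<in> U \<longrightarrow> f s \<in> C" "open U" "t \<in> U"
  shows "l \<in> C"
proof -
  obtain d where "d > 0" "side r t d \<subseteq> U"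
    by (rule side_in_open[OF assms(4,5)])
  have "AE s in lebesgue. s \<in> side r t d \<longrightarrow> f s \<in> C"
    using assms(3) by (rule eventually_mono) (use \<open>side r t d \<subseteq> U\<close> in blast)
  with \<open>d > 0\<close> have "eventually (\<lambda>s. f s \<in> C) (ess_at r t)"
    unfolding eventually_ess_at by (intro exI conjI)
  then show ?thesis
    using Lim_in_closed_set[OF assms(2) _ ess_at_neq_bot assms(1)] by blast
qed

text \<open>One \<open>d\<close> serves the almost-everywhere values and all one-sided limits at
  nearby points; this is the source of continuity on \<open>I_*\<close>.\<close>

lemma slim_near:
  assumes "X \<in> G_space I" "t \<in> I" "e > 0"
  obtains d where "d > 0" "side r t d \<subseteq> I"
    "\<forall>s\<in>side r t d. \<forall>q. dist (slim q X s) (slim r X t) \<le> e"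
    "AE s in lebesgue. s \<in> side r t d \<longrightarrow> dist (rep X s) (slim r X t) \<le> e"
proof -
  have "eventually (\<lambda>s. dist (rep X s) (slim r X t) < e) (ess_at r t)"
    using tendstoD[OF rep_tendsto_slim[OF assms(1,2)] assms(3)] .
  then obtain d1 where d1: "d1 > 0"
    "AE s in lebesgue. s \<in> side r t d1 \<longrightarrow> dist (rep X s) (slim r X t) < e"
    unfolding eventually_ess_at by blast
  obtain d2 where d2: "d2 > 0" "side r t d2 \<subseteq> I"
    by (rule side_in_open[OF open_I \<open>t \<in> I\<close>])
  let ?d = "min d1 d2"
  have ae: "AE s in lebesgue. s \<in> side r t ?d \<longrightarrow> dist (rep X s) (slim r X t) \<le> e"
    using d1(2) by eventually_elim (use side_mono[of ?d d1 r t] in auto)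
  show thesis
  proof (rule that)
    show "?d > 0" "side r t ?d \<subseteq> I"
      using d1(1) d2 side_mono[of ?d d2 r t] by auto
    \<comment> \<open>The set \<open>side r t ?d\<close> is open and contains \<open>s\<close>, so
      on either side of \<open>s\<close> the representative stays almost everywhere in the closed
      ball around \<open>slim r X t\<close>.\<close>
    then have "dist (slim q X s) (slim r X t) \<le> e" if "s \<in> side r t ?d" for s q
      using tendsto_ess_at_in_closed[of "rep X" "slim q X s" q s "cball (slim r X t) e" "side r t ?d"]
        rep_tendsto_slim[OF assms(1), of s q] ae that open_side
      by (auto simp: dist_commute)
    then show "\<forall>s\<in>side r t ?d. \<forall>q. dist (slim q X s) (slim r X t) \<le> e"
      by blast
  qed (use ae in simp)
qed

text \<open>On a short side of any \<open>t\<close>, both \<open>rep X s\<close> (for almost every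
  \<open>s\<close>) and \<open>slim q X s\<close> are within \<open>1 / Suc n\<close> of
  \<open>slim r X t\<close>, hence within \<open>2 / Suc n\<close> of each other.
  \<open>AE_from_local\<close> globalizes this for each \<open>n\<close>, and countably many
  \<open>n\<close> give equality.\<close>

lemma AE_rep_eq_slim:
  assumes "X \<in> G_space I"
  shows "AE s in lebesgue_on I. rep X s = slim q X s"
proof -
  have "AE s in lebesgue. s \<in> I \<longrightarrow> dist (rep X s) (slim q X s) \<le> 2 / Suc n" for n
  proof (rule AE_from_local)
    fix t assume "t \<in> I"
    have "\<exists>d>0. AE s in lebesgue. s \<in> side r t d \<longrightarrow> dist (rep X s) (slim q X s) \<le> 2 / Suc n" for r
    proof -
      have "1 / real (Suc n) > 0"
        by simp
      then obtain d where d: "d > 0" "side r t d \<subseteq> I"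
        "\<forall>s\<in>side r t d. \<forall>q. dist (slim q X s) (slim r X t) \<le> 1 / Suc n"
        "AE s in lebesgue. s \<in> side r t d \<longrightarrow> dist (rep X s) (slim r X t) \<le> 1 / Suc n"
        by (rule slim_near[OF assms \<open>t \<in> I\<close>, where r = r])
      have "dist (rep X s) (slim q X s) \<le> 2 / Suc n"
        if "dist (rep X s) (slim r X t) \<le> 1 / Suc n" "s \<in> side r t d" for s
      proof -
        have "dist (rep X s) (slim q X s) \<le> 1 / Suc n + 1 / Suc n"
          using dist_triangle2[of "rep X s" "slim q X s" "slim r X t"] that d(3)
          by (meson add_mono order_trans)
        also have "\<dots> = 2 / Suc n"
          by simp
        finally show ?thesis .
      qed
      then have "AE s in lebesgue. s \<in> side r t d \<longrightarrow> dist (rep X s) (slim q X s) \<le> 2 / Suc n"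
        using d(4) by (auto elim!: eventually_mono)
      with d(1) show ?thesis
        by (intro exI conjI)
    qed
    then obtain d where d: "\<And>r. d r > 0 \<and> (AE s in lebesgue. s \<in> side r t (d r) \<longrightarrow>
        dist (rep X s) (slim q X s) \<le> 2 / Suc n)"
      by metis
    have "AE s in lebesgue. s \<in> side r t (min (d True) (d False)) \<longrightarrow>
        dist (rep X s) (slim q X s) \<le> 2 / Suc n" for r
    proof -
      have "side r t (min (d True) (d False)) \<subseteq> side r t (d r)"
        by (rule side_mono) (cases r; simp)
      then show ?thesis
        using conjunct2[OF d[of r]] by (auto elim!: eventually_mono)
    qed
    then show "\<exists>d>0. \<forall>r. AE s in lebesgue. s \<in> side r t d \<longrightarrow> dist (rep X s) (slim q X s) \<le> 2 / Suc n"
      using d(1) by (intro exI[of _ "min (d True) (d False)"]) simp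
  qed
  then have "AE s in lebesgue. \<forall>n. s \<in> I \<longrightarrow> dist (rep X s) (slim q X s) \<le> 2 / Suc n"
    by (subst AE_all_countable) blast
  then show ?thesis
    unfolding AE_on_iff
  proof (rule eventually_mono, intro impI)
    fix s assume *: "\<forall>n. s \<in> I \<longrightarrow> dist (rep X s) (slim q X s) \<le> 2 / Suc n" "s \<in> I"
    have "(\<lambda>n. 2 / real (Suc n)) \<longlonglongrightarrow> 0"
      using LIMSEQ_Suc[OF lim_const_over_n[of 2]] by simp
    then have "dist (rep X s) (slim q X s) \<le> 0"
      by (rule tendsto_lowerbound) (use * in auto)
    then show "rep X s = slim q X s"
      by simp
  qed
qed

text \<open>Right limits suffice because a representative agrees with them almost
  everywhere.\<close>

lemma G_space_eqI:
  assumes "X \<in> G_space I" "Y \<in> G_space I" "\<And>t. t \<in> I \<Longrightarrow> slim True X t = slim True Y t"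
  shows "X = Y"
proof -
  have "AE s in lebesgue_on I. s \<in> I"
    by (simp add: AE_on_iff)
  with AE_rep_eq_slim[OF assms(1), of True] AE_rep_eq_slim[OF assms(2), of True]
  have "AE s in lebesgue_on I. rep X s = rep Y s"
    by eventually_elim (simp add: assms(3))
  then show ?thesis
    using ae_class_rep assms(1,2) ae_class_eq_iff by metis
qed

section \<open>Linear operations and the supremum norm on classes\<close>

lemma
  assumes "X \<in> G_space I" "Y \<in> G_space I"
  shows cl_add_in_G_space: "cl_add I X Y \<in> G_space I"
    and slim_cl_add: "t \<in> I \<Longrightarrow> slim r (cl_add I X Y) t = slim r X t + slim r Y t"
proof -
  have lim: "((\<lambda>t. rep X t + rep Y t) \<longlongrightarrow> slim r X t + slim r Y t) (ess_at r t)" if "t \<in> I" for r t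
    by (intro tendsto_add rep_tendsto_slim assms that)
  then show "t \<in> I \<Longrightarrow> slim r (cl_add I X Y) t = slim r X t + slim r Y t"
    unfolding cl_add_def by (rule slim_ae_class)
  obtain C D where "AE t in lebesgue_on I. cmod (rep X t) \<le> C" "AE t in lebesgue_on I. cmod (rep Y t) \<le> D"
    using assms[THEN rep_in_G_fun] by (auto simp: G_fun_def)
  then have "AE t in lebesgue_on I. cmod (rep X t + rep Y t) \<le> C + D"
    by eventually_elim (rule order_trans[OF norm_triangle_ineq add_mono])
  moreover have "(\<lambda>t. rep X t + rep Y t) \<in> borel_measurable (lebesgue_on I)"
    using assms[THEN rep_in_G_fun] by (auto simp: G_fun_def)
  ultimately show "cl_add I X Y \<in> G_space I"
    unfolding cl_add_def using lim by (intro ae_class_in_G_space G_funI)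
qed

lemma
  assumes "X \<in> G_space I"
  shows cl_scale_in_G_space: "cl_scale I c X \<in> G_space I"
    and slim_cl_scale: "t \<in> I \<Longrightarrow> slim r (cl_scale I c X) t = c * slim r X t"
proof -
  have lim: "((\<lambda>t. c * rep X t) \<longlongrightarrow> c * slim r X t) (ess_at r t)" if "t \<in> I" for r t
    by (intro tendsto_mult tendsto_const rep_tendsto_slim assms that)
  then show "t \<in> I \<Longrightarrow> slim r (cl_scale I c X) t = c * slim r X t"
    unfolding cl_scale_def by (rule slim_ae_class)
  obtain C where "AE t in lebesgue_on I. cmod (rep X t) \<le> C"
    using assms[THEN rep_in_G_fun] by (auto simp: G_fun_def)
  then have "AE t in lebesgue_on I. cmod (c * rep X t) \<le> cmod c * C"
    by eventually_elim (simp add: norm_mult mult_left_mono)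
  moreover have "(\<lambda>t. c * rep X t) \<in> borel_measurable (lebesgue_on I)"
    using assms[THEN rep_in_G_fun] by (auto simp: G_fun_def)
  ultimately show "cl_scale I c X \<in> G_space I"
    unfolding cl_scale_def using lim by (intro ae_class_in_G_space G_funI)
qed

lemma cl_diff_eq:
  assumes "X \<in> G_space I" "Y \<in> G_space I"
  shows "cl_diff I X Y = cl_add I X (cl_scale I (- 1) Y)"
  unfolding cl_diff_def cl_add_def ae_class_eq_iff
  using AE_rep_ae_class[of I "\<lambda>t. - 1 * rep Y t", folded cl_scale_def]
  by eventually_elim simp

lemma bounded_slim:
  assumes "X \<in> G_space I"
  obtains C where "\<And>r t. t \<in> I \<Longrightarrow> cmod (slim r X t) \<le> C"
proof -
  obtain C where C: "AE t in lebesgue_on I. cmod (rep X t) \<le> C"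
    using assms[THEN rep_in_G_fun] by (auto simp: G_fun_def)
  show thesis
  proof (rule that)
    fix r t assume "t \<in> I"
    then have "slim r X t \<in> cball 0 C"
      using C rep_tendsto_slim[OF assms \<open>t \<in> I\<close>] open_I
      by (intro tendsto_ess_at_in_closed[of "rep X" _ r t _ I]) (auto simp: AE_on_iff)
    then show "cmod (slim r X t) \<le> C"
      by simp
  qed
qed

text \<open>\<le> holds since the representative is almost everywhere one of its one-sided limits;
  \<ge> holds since each such limit is approached by values that are almost everywhere below the
  essential supremum.\<close>

lemma Linf_norm_eq:
  assumes "X \<in> G_space I"
  shows "Linf_norm I X = (SUP p\<in>UNIV \<times> I. cmod (slim (fst p) X (snd p)))" (is "_ = ?S")
proof -
  let ?N = "\<lambda>t. ereal (cmod (rep X t))"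
  obtain C where C: "\<And>r t. t \<in> I \<Longrightarrow> cmod (slim r X t) \<le> C"
    using bounded_slim[OF assms] by blast
  have bdd: "bdd_above ((\<lambda>p. cmod (slim (fst p) X (snd p))) ` (UNIV \<times> I))"
    using C by (intro bdd_aboveI[of _ C]) auto
  have "AE s in lebesgue_on I. s \<in> I"
    by (simp add: AE_on_iff)
  with AE_rep_eq_slim[OF assms, of True] have "AE s in lebesgue_on I. ?N s \<le> ereal ?S"
  proof eventually_elim
    case (elim s)
    then show ?case
      using cSUP_upper[OF _ bdd, of "(True, s)"] by simp
  qed
  moreover have meas: "?N \<in> borel_measurable (lebesgue_on I)"
    using rep_in_G_fun[OF assms] by (auto simp: G_fun_def)
  ultimately have le: "esssup (lebesgue_on I) ?N \<le> ereal ?S"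
    by (rule esssup_I[rotated])
  have ge: "ereal (cmod (slim r X t)) \<le> esssup (lebesgue_on I) ?N" if "t \<in> I" for r t
  proof -
    have lim: "((\<lambda>s. ?N s) \<longlongrightarrow> ereal (cmod (slim r X t))) (ess_at r t)"
      by (intro tendsto_intros rep_tendsto_slim assms that)
    have "eventually (\<lambda>s. ?N s \<le> esssup (lebesgue_on I) ?N) (ess_at r t)"
      by (rule eventually_ess_at_AE[OF esssup_AE that])
    then show ?thesis
      by (rule tendsto_upperbound[OF lim _ ess_at_neq_bot])
  qed
  obtain t0 where "t0 \<in> I"
    using nonempty_I by blast
  \<comment> \<open>\<open>real_of_ereal\<close> sends infinite values to 0, so finiteness has to be
    established first; the essential supremum lies between two real numbers.\<close>
  obtain E where E: "esssup (lebesgue_on I) ?N = ereal E"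
    using le ge[OF \<open>t0 \<in> I\<close>, of True] by (cases "esssup (lebesgue_on I) ?N") auto
  have "?S \<le> E"
    using ge E nonempty_I by (intro cSUP_least) auto
  with le E show ?thesis
    by (simp add: Linf_norm_def)
qed

section \<open>Indicator classes\<close>

lemma step_in_G_space:
  assumes "u < v"
  shows "ae_class I (\<lambda>s. if u < s \<and> s < v then 1 else 0) \<in> G_space I"
proof (intro ae_class_in_G_space G_funI)
  show "AE t in lebesgue_on I. cmod (if u < t \<and> t < v then 1 else 0) \<le> 1"
    by (rule AE_I2) auto
  have "{s. u < s \<and> s < v} = {u<..<v}"
    by auto
  then have "(\<lambda>s. if u < s \<and> s < v then 1 else 0 :: complex) \<in> borel_measurable borel"
    by (intro measurable_If) auto
  then show "(\<lambda>s. if u < s \<and> s < v then 1 else 0 :: complex) \<in> borel_measurable (lebesgue_on I)"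
    by (intro measurable_restrict_space1 measurable_completion) simp
qed (rule tendsto_indicator_ess_at[OF assms])

lemma side_indicator:
  assumes "d > 0"
  obtains X where "X \<in> G_space I" "t \<in> I \<Longrightarrow> slim r X t \<noteq> 0"
    "\<And>q s. s \<in> I \<Longrightarrow> slim q X s \<noteq> 0 \<Longrightarrow> s \<in> side r t d \<or> (s = t \<and> q = r)"
proof -
  \<comment> \<open>Half the length keeps the far endpoint inside the open
    \<open>side r t d\<close>; one of the two one-sided limits at that endpoint is still 1.\<close>
  define u v where "u = (if r then t else t - d / 2)" and "v = (if r then t + d / 2 else t)"
  have "u < v"
    using assms by (simp add: u_def v_def)
  let ?X = "ae_class I (\<lambda>s. if u < s \<and> s < v then 1 else 0)"
  have X: "slim q ?X s = (if (if q then u \<le> s \<and> s < v else u < s \<and> s \<le> v) then 1 else 0)"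
    if "s \<in> I" for q s
    by (rule slim_ae_class[OF tendsto_indicator_ess_at[OF \<open>u < v\<close>] that])
  show thesis
  proof (rule that[of ?X])
    show "?X \<in> G_space I"
      by (rule step_in_G_space[OF \<open>u < v\<close>])
    show "t \<in> I \<Longrightarrow> slim r ?X t \<noteq> 0"
      using assms by (simp only: X) (simp add: u_def v_def)
    fix q s assume "s \<in> I" "slim q ?X s \<noteq> 0"
    then have "if q then u \<le> s \<and> s < v else u < s \<and> s \<le> v"
      using X[OF \<open>s \<in> I\<close>, of q] by (auto split: if_splits)
    then show "s \<in> side r t d \<or> (s = t \<and> q = r)"
      using assms by (auto simp: u_def v_def side_def split: if_splits)
  qed
qed

section \<open>The space \<open>I\<^sub>*\<close> and continuous functions on it\<close>

definition pt :: "bool \<Rightarrow> real \<Rightarrow> gpoint" where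
  "pt r t = (if r then pt_right I t else pt_left I t)"

text \<open>The Gelfand transform of \<open>X\<close>, restricted to the characters in
  \<open>I_*\<close> and made extensional as \<open>C_star\<close> requires.\<close>

definition hat :: "fclass \<Rightarrow> gpoint \<Rightarrow> complex" where
  "hat X = (\<lambda>p\<in>Istar I. p X)"

lemma pt_apply: "X \<in> G_space I \<Longrightarrow> pt r t X = slim r X t"
  by (simp add: pt_def pt_right_def pt_left_def slim_def)

lemma Istar_eq: "Istar I = {pt r t |r t. t \<in> I}"
proof -
  have "p \<in> Istar I \<longleftrightarrow> (\<exists>t\<in>I. p = pt True t) \<or> (\<exists>t\<in>I. p = pt False t)" for p
    by (auto simp: Istar_def pt_def)
  then show ?thesis
    by (auto simp: ex_bool_eq)
qed

lemma pt_in_Istar: "t \<in> I \<Longrightarrow> pt r t \<in> Istar I"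
  by (auto simp: Istar_eq)

lemma Istar_cases:
  assumes "p \<in> Istar I"
  obtains r t where "t \<in> I" "p = pt r t"
  using assms by (auto simp: Istar_eq)

lemma hat_pt: "X \<in> G_space I \<Longrightarrow> t \<in> I \<Longrightarrow> hat X (pt r t) = slim r X t"
  by (simp add: hat_def pt_in_Istar pt_apply)

text \<open>For \<open>s\<close> different from \<open>t\<close>, the indicator with
  \<open>d\<close> equal to the distance of \<open>s\<close> and \<open>t\<close> vanishes at
  \<open>s\<close>. For \<open>s = t\<close> the indicator is nonzero from the side \<open>r\<close>
  only, so it tells \<open>t+\<close> from \<open>t-\<close>.\<close>

lemma pt_inject:
  assumes "s \<in> I" "t \<in> I"
  shows "pt q s = pt r t \<longleftrightarrow> q = r \<and> s = t"
proof
  assume eq: "pt q s = pt r t"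
  have *: "s \<in> side r t d \<or> (s = t \<and> q = r)" if "d > 0" for d
  proof -
    obtain X where X: "X \<in> G_space I" "t \<in> I \<Longrightarrow> slim r X t \<noteq> 0"
      "\<And>q s. s \<in> I \<Longrightarrow> slim q X s \<noteq> 0 \<Longrightarrow> s \<in> side r t d \<or> (s = t \<and> q = r)"
      using side_indicator[OF \<open>d > 0\<close>, of t r] by metis
    have "slim q X s = slim r X t"
      using eq X(1) by (metis pt_apply)
    then show ?thesis
      using X assms by simp
  qed
  have "s = t"
  proof (rule ccontr)
    assume "s \<noteq> t"
    then have "s \<in> side r t \<bar>s - t\<bar>"
      using *[of "\<bar>s - t\<bar>"] by simp
    then show False
      using side_subset_ball[of r t "\<bar>s - t\<bar>"] by (auto simp: dist_real_def)
  qed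
  then show "q = r \<and> s = t"
    using *[of 1] not_in_side by auto
qed simp

lemma base_pt_pt:
  assumes "t \<in> I"
  shows "base_pt I (pt r t) = t"
  unfolding base_pt_def
proof (rule the_equality)
  show "t \<in> I \<and> (pt r t = pt_left I t \<or> pt r t = pt_right I t)"
    using assms by (simp add: pt_def)
  fix s assume s: "s \<in> I \<and> (pt r t = pt_left I s \<or> pt r t = pt_right I s)"
  then have "pt r t = pt False s \<or> pt r t = pt True s"
    by (simp add: pt_def)
  then show "s = t"
    using pt_inject[of t s] s assms by blast
qed

lemma topspace_Istar: "topspace (Istar_topology I) = Istar I"
  by (auto simp: Istar_topology_def pointwise_topology_def Istar_def pt_left_def pt_right_def)

lemma continuous_map_eval_Istar:
  assumes "X \<in> G_space I"
  shows "continuous_map (Istar_topology I) euclidean (\<lambda>p. p X)"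
  unfolding Istar_topology_def pointwise_topology_def
  by (intro continuous_map_from_subtopology continuous_map_product_projection assms)

section \<open>Punctured neighbourhoods and limits in \<open>I_*\<close>\<close>

lemma slim_tendsto:
  assumes "X \<in> G_space I" "t \<in> I"
  shows "((\<lambda>s. slim q X s) \<longlongrightarrow> slim r X t) (at_side r t)"
proof (rule tendstoI)
  fix e :: real assume "e > 0"
  then have "e / 2 > 0"
    by simp
  then obtain d where d: "d > 0" "side r t d \<subseteq> I"
    "\<forall>s\<in>side r t d. \<forall>q. dist (slim q X s) (slim r X t) \<le> e / 2"
    "AE s in lebesgue. s \<in> side r t d \<longrightarrow> dist (rep X s) (slim r X t) \<le> e / 2"
    by (rule slim_near[OF assms, where r = r])
  have "\<forall>s\<in>side r t d. dist (slim q X s) (slim r X t) < e"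
    using d(3) \<open>e > 0\<close> by (auto intro: le_less_trans[of _ "e / 2"])
  with d(1) show "eventually (\<lambda>s. dist (slim q X s) (slim r X t) < e) (at_side r t)"
    unfolding eventually_at_side by blast
qed

lemma eventually_at_side_mem_I: "t \<in> I \<Longrightarrow> eventually (\<lambda>s. s \<in> I) (at_side r t)"
  by (rule eventually_at_side_mem[OF open_I])

text \<open>The class of the indicator of \<open>(t, t + \<delta>)\<close> is nonzero at \<open>t+\<close>, and zero at \<open>t-\<close> and at all
  \<open>s-\<close>, \<open>s+\<close> with \<open>s\<close> outside \<open>[t, t + \<delta>]\<close>, so it cuts out a small neighbourhood of \<open>t+\<close>.\<close>

lemma eventually_atin_pt:
  assumes "t \<in> I"
  shows "eventually P (atin (Istar_topology I) (pt r t)) \<longleftrightarrow>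
    eventually (\<lambda>s. \<forall>q. P (pt q s)) (at_side r t)"
proof
  assume "eventually P (atin (Istar_topology I) (pt r t))"
  then obtain U where U: "openin (Istar_topology I) U" "pt r t \<in> U" "\<forall>p\<in>U - {pt r t}. P p"
    using pt_in_Istar[OF assms] by (auto simp: eventually_atin topspace_Istar)
  then obtain V where V: "openin (product_topology (\<lambda>_. euclidean) (G_space I)) V" "U = V \<inter> Istar I"
    by (auto simp: Istar_topology_def pointwise_topology_def openin_subtopology)
  then obtain W where W: "finite {X \<in> G_space I. W X \<noteq> UNIV}" "\<forall>X\<in>G_space I. open (W X)"
    "pt r t \<in> Pi\<^sub>E (G_space I) W" "Pi\<^sub>E (G_space I) W \<subseteq> V"
    using U(2) unfolding openin_product_topology_alt by (auto; metis)
  \<comment> \<open>A basic neighbourhood in the product constrains only finitely many classes, so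
    the one-sided neighbourhoods supplied by \<open>slim_tendsto\<close> can be intersected.\<close>
  have "\<forall>X\<in>{X \<in> G_space I. W X \<noteq> UNIV}. eventually (\<lambda>s. \<forall>q. slim q X s \<in> W X) (at_side r t)"
  proof (intro ballI eventually_all_finite)
    fix X q assume X: "X \<in> {X \<in> G_space I. W X \<noteq> UNIV}"
    then have "slim r X t \<in> W X"
      using W(3) pt_apply by (fastforce simp: PiE_iff)
    then show "eventually (\<lambda>s. slim q X s \<in> W X) (at_side r t)"
      using slim_tendsto[of X t q r] X W(2) assms by (auto dest: topological_tendstoD)
  qed
  then have "eventually (\<lambda>s. \<forall>X\<in>{X \<in> G_space I. W X \<noteq> UNIV}. \<forall>q. slim q X s \<in> W X) (at_side r t)"
    by (rule eventually_ball_finite[OF W(1)])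
  moreover have "eventually (\<lambda>s. s \<noteq> t) (at_side r t)"
    unfolding eventually_at_side using not_in_side by (metis zero_less_one)
  ultimately show "eventually (\<lambda>s. \<forall>q. P (pt q s)) (at_side r t)"
    using eventually_at_side_mem_I[OF assms, of r]
  proof eventually_elim
    case (elim s)
    show ?case
    proof
      fix q
      have "pt q s X \<in> W X" if "X \<in> G_space I" for X
        using elim(1) that by (cases "W X = UNIV") (auto simp: pt_apply)
      moreover have "pt q s \<in> extensional (G_space I)"
        by (simp add: pt_def pt_right_def pt_left_def)
      ultimately have "pt q s \<in> Pi\<^sub>E (G_space I) W"
        by (auto simp: PiE_iff)
      then have "pt q s \<in> U"
        using V(2) W(4) pt_in_Istar[OF elim(3)] by blast
      then show "P (pt q s)"
        using U(3) pt_inject[OF elim(3) assms] elim(2) by blast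
    qed
  qed
next
  assume "eventually (\<lambda>s. \<forall>q. P (pt q s)) (at_side r t)"
  then obtain d where d: "d > 0" "\<forall>s\<in>side r t d. \<forall>q. P (pt q s)"
    unfolding eventually_at_side by blast
  obtain X where X: "X \<in> G_space I" "t \<in> I \<Longrightarrow> slim r X t \<noteq> 0"
    "\<And>q s. s \<in> I \<Longrightarrow> slim q X s \<noteq> 0 \<Longrightarrow> s \<in> side r t d \<or> (s = t \<and> q = r)"
    using side_indicator[OF \<open>d > 0\<close>, of t r] by metis
  let ?U = "{p \<in> topspace (Istar_topology I). p X \<in> - {0}}"
  have "openin (Istar_topology I) ?U"
    by (rule openin_continuous_map_preimage[OF continuous_map_eval_Istar[OF X(1)]]) (simp add: open_Compl)
  moreover have "pt r t \<in> ?U"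
    using X assms by (simp add: topspace_Istar pt_in_Istar pt_apply)
  moreover have "P p" if "p \<in> ?U - {pt r t}" for p
  proof -
    have "p \<in> Istar I"
      using that by (simp add: topspace_Istar)
    then obtain q s where p: "s \<in> I" "p = pt q s"
      by (rule Istar_cases)
    then have "s \<in> side r t d"
      using X(3)[of s q] that by (auto simp: pt_apply[OF X(1)])
    then show ?thesis
      using d(2) p by blast
  qed
  ultimately show "eventually P (atin (Istar_topology I) (pt r t))"
    unfolding eventually_atin by blast
qed

text \<open>Points \<open>s-\<close> and \<open>s+\<close> both approach \<open>t+\<close>, so both
  families must tend to the same \<open>l\<close>. The quantifier over \<open>q\<close> moves
  through \<open>eventually\<close> because there are only two flags.\<close>

lemma tendsto_atin_pt:
  assumes "t \<in> I"
  shows "(g \<longlongrightarrow> l) (atin (Istar_topology I) (pt r t)) \<longleftrightarrow>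
    (\<forall>q. ((\<lambda>s. g (pt q s)) \<longlongrightarrow> l) (at_side r t))"
proof -
  have "eventually (\<lambda>s. \<forall>q. Q s q) F \<longleftrightarrow> (\<forall>q. eventually (\<lambda>s. Q s q) F)"
    for Q :: "real \<Rightarrow> bool \<Rightarrow> bool" and F
    by (auto simp: all_bool_eq eventually_conj_iff)
  then show ?thesis
    unfolding tendsto_def by (auto simp: eventually_atin_pt[OF assms])
qed

section \<open>Difference quotients on \<open>I_*\<close> and on classes\<close>

lemma has_star_deriv_at_pt:
  assumes "t \<in> I"
  shows "has_star_deriv_at I g (pt r t) l \<longleftrightarrow>
    (\<forall>q. ((\<lambda>s. (g (pt q s) - g (pt r t)) / of_real (s - t)) \<longlongrightarrow> l) (at_side r t))"
proof -
  have "eventually (\<lambda>s. (g (pt q s) - g (pt r t)) / of_real (base_pt I (pt q s) - base_pt I (pt r t)) =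
      (g (pt q s) - g (pt r t)) / of_real (s - t)) (at_side r t)" for q
    using eventually_at_side_mem_I[OF assms]
    by eventually_elim (simp add: base_pt_pt assms)
  then show ?thesis
    unfolding has_star_deriv_at_def tendsto_atin_pt[OF assms]
    by (intro all_cong1 tendsto_cong)
qed

lemma has_star_deriv_at_unique:
  assumes "p \<in> Istar I" "has_star_deriv_at I g p l" "has_star_deriv_at I g p m"
  shows "l = m"
proof -
  obtain r t where p: "t \<in> I" "p = pt r t"
    using assms(1) by (rule Istar_cases)
  show ?thesis
    using assms(2,3) unfolding p(2) has_star_deriv_at_pt[OF p(1)]
    by (meson tendsto_unique[OF at_side_neq_bot])
qed

text \<open>From left to right, fix \<open>s\<close> on the given side of \<open>t\<close>: as
  \<open>u\<close> tends to \<open>s\<close> essentially from the side \<open>q\<close>, the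
  quotient of \<open>rep X\<close> at \<open>u\<close> tends to that of \<open>slim q X\<close> at
  \<open>s\<close>, and the closed bound \<open>e / 2\<close> survives. From right to left,
  \<open>rep X\<close> may be replaced by its right limits, with which it agrees almost
  everywhere.\<close>

lemma difference_quotient_limits:
  assumes X: "X \<in> G_space I" and "t \<in> I"
  shows "((\<lambda>s. (rep X s - c) / of_real (s - t)) \<longlongrightarrow> l) (ess_at r t) \<longleftrightarrow>
    (\<forall>q. ((\<lambda>s. (slim q X s - c) / of_real (s - t)) \<longlongrightarrow> l) (at_side r t))"
    (is "?L \<longleftrightarrow> ?R")
proof
  assume ?L
  show ?R
  proof (intro allI tendstoI)
    fix q and e :: real assume "e > 0"
    then have "e / 2 > 0"
      by simp
    from tendstoD[OF \<open>?L\<close> this] obtain d where d: "d > 0"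
      "AE s in lebesgue. s \<in> side r t d \<longrightarrow> dist ((rep X s - c) / of_real (s - t)) l < e / 2"
      unfolding eventually_ess_at by blast
    have ae: "AE s in lebesgue. s \<in> side r t d \<longrightarrow> (rep X s - c) / of_real (s - t) \<in> cball l (e / 2)"
      using d(2) by (auto elim!: eventually_mono simp: dist_commute)
    have "eventually (\<lambda>s. s \<in> side r t d) (at_side r t)"
      using d(1) unfolding eventually_at_side by blast
    with eventually_at_side_mem_I[OF \<open>t \<in> I\<close>]
    show "eventually (\<lambda>s. dist ((slim q X s - c) / of_real (s - t)) l < e) (at_side r t)"
    proof eventually_elim
      case (elim s)
      have "s \<noteq> t"
        using elim(2) not_in_side by blast
      have "((\<lambda>u. u) \<longlongrightarrow> s) (ess_at q s)"
        by (rule tendsto_mono[OF order_trans[OF ess_at_le at_side_le_at] tendsto_ident_at])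
      then have "((\<lambda>u. (rep X u - c) / of_real (u - t)) \<longlongrightarrow> (slim q X s - c) / of_real (s - t)) (ess_at q s)"
        using \<open>s \<noteq> t\<close> by (intro tendsto_intros rep_tendsto_slim X elim(1)) simp_all
      then have "(slim q X s - c) / of_real (s - t) \<in> cball l (e / 2)"
        using tendsto_ess_at_in_closed[OF _ closed_cball ae open_side elim(2)] by blast
      then show ?case
        using \<open>e > 0\<close> by (simp add: dist_commute)
    qed
  qed
next
  assume ?R
  then have "((\<lambda>s. (slim True X s - c) / of_real (s - t)) \<longlongrightarrow> l) (ess_at r t)"
    using tendsto_mono[OF ess_at_le] by blast
  moreover have "eventually (\<lambda>s. (slim True X s - c) / of_real (s - t) = (rep X s - c) / of_real (s - t)) (ess_at r t)"
    using eventually_ess_at_AE[OF AE_rep_eq_slim[OF X, of True] \<open>t \<in> I\<close>, of r]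
    by eventually_elim simp
  ultimately show ?L
    by (rule Lim_transform_eventually)
qed

lemma has_G_deriv_iff:
  assumes X: "X \<in> G_space I"
  shows "has_G_deriv I X Y \<longleftrightarrow>
    Y \<in> G_space I \<and> (\<forall>p\<in>Istar I. has_star_deriv_at I (hat X) p (hat Y p))"
proof -
  have *: "has_star_deriv_at I (hat X) (pt r t) (slim r Y t) \<longleftrightarrow>
      ((\<lambda>s. (rep X s - slim r X t) / of_real (s - t)) \<longlongrightarrow> slim r Y t) (ess_at r t)"
    if "t \<in> I" for r t
  proof -
    have "eventually (\<lambda>s. (hat X (pt q s) - hat X (pt r t)) / of_real (s - t) =
        (slim q X s - slim r X t) / of_real (s - t)) (at_side r t)" for q
      using eventually_at_side_mem_I[OF that] by eventually_elim (simp add: hat_pt X that)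
    then have "(\<forall>q. ((\<lambda>s. (hat X (pt q s) - hat X (pt r t)) / of_real (s - t)) \<longlongrightarrow> slim r Y t) (at_side r t))
      \<longleftrightarrow> (\<forall>q. ((\<lambda>s. (slim q X s - slim r X t) / of_real (s - t)) \<longlongrightarrow> slim r Y t) (at_side r t))"
      by (intro all_cong1 tendsto_cong)
    then show ?thesis
      by (simp only: has_star_deriv_at_pt[OF that] difference_quotient_limits[OF X that])
  qed
  have "(\<forall>p\<in>Istar I. has_star_deriv_at I (hat X) p (hat Y p)) \<longleftrightarrow>
    (\<forall>t\<in>I. \<forall>r. ((\<lambda>s. (rep X s - slim r X t) / of_real (s - t)) \<longlongrightarrow> slim r Y t) (ess_at r t))"
    (is "?A \<longleftrightarrow> ?B") if "Y \<in> G_space I"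
  proof -
    have "?A \<longleftrightarrow> (\<forall>t\<in>I. \<forall>r. has_star_deriv_at I (hat X) (pt r t) (hat Y (pt r t)))"
      by (auto simp: Istar_eq)
    then show ?thesis
      using * by (simp add: hat_pt that)
  qed
  then show ?thesis
    unfolding has_G_deriv_def by (auto simp: all_bool_eq slim_def ess_at_def)
qed

section \<open>The correspondence between classes and continuous functions on
  \<open>I_*\<close>\<close>

lemma hat_inject:
  assumes "X \<in> G_space I" "Y \<in> G_space I" "hat X = hat Y"
  shows "X = Y"
proof (rule G_space_eqI[OF assms(1,2)])
  fix t assume "t \<in> I"
  then show "slim True X t = slim True Y t"
    using hat_pt[OF assms(1), of t True] hat_pt[OF assms(2), of t True] assms(3) by simp
qed

lemma hat_extensional: "hat X \<in> extensional (Istar I)"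
  by (simp add: hat_def)

lemma hat_cl_add: "X \<in> G_space I \<Longrightarrow> Y \<in> G_space I \<Longrightarrow> hat (cl_add I X Y) = pw_add (Istar I) (hat X) (hat Y)"
  by (rule extensionalityI[OF hat_extensional])
    (auto simp: pw_add_def Istar_eq hat_pt cl_add_in_G_space slim_cl_add)

lemma hat_cl_scale: "X \<in> G_space I \<Longrightarrow> hat (cl_scale I c X) = pw_scale (Istar I) c (hat X)"
  by (rule extensionalityI[OF hat_extensional])
    (auto simp: pw_scale_def Istar_eq hat_pt cl_scale_in_G_space slim_cl_scale)

lemma cl_diff_in_G_space: "X \<in> G_space I \<Longrightarrow> Y \<in> G_space I \<Longrightarrow> cl_diff I X Y \<in> G_space I"
  by (simp add: cl_diff_eq cl_add_in_G_space cl_scale_in_G_space)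

lemma hat_cl_diff: "X \<in> G_space I \<Longrightarrow> Y \<in> G_space I \<Longrightarrow> hat (cl_diff I X Y) = pw_diff (Istar I) (hat X) (hat Y)"
  by (simp add: cl_diff_eq hat_cl_add hat_cl_scale cl_scale_in_G_space)
    (auto simp: pw_add_def pw_scale_def pw_diff_def)

lemma hat_in_C_star:
  assumes X: "X \<in> G_space I"
  shows "hat X \<in> C_star I"
proof -
  have "continuous_map (Istar_topology I) euclidean (hat X)"
    using continuous_map_eval_Istar[OF X]
    by (rule continuous_map_eq) (simp add: topspace_Istar hat_def)
  moreover obtain C where "\<And>r t. t \<in> I \<Longrightarrow> cmod (slim r X t) \<le> C"
    using bounded_slim[OF X] by blast
  then have "bounded (hat X ` Istar I)"
    by (intro boundedI[of _ C]) (auto simp: Istar_eq hat_pt[OF X])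
  ultimately show ?thesis
    by (simp add: C_star_def hat_extensional)
qed

text \<open>\<open>f\<close> is the limit of the step functions obtained by sampling it at the next larger multiple
  of \<open>1 / (n + 1)\<close>.\<close>

lemma borel_measurable_right_continuous:
  fixes f :: "real \<Rightarrow> complex"
  assumes "\<And>t. t \<in> I \<Longrightarrow> (f \<longlongrightarrow> f t) (at_right t)"
  shows "f \<in> borel_measurable (lebesgue_on I)"
proof (rule borel_measurable_LIMSEQ_metric)
  define x where "x n s = (of_int \<lfloor>s * real (Suc n)\<rfloor> + 1) / real (Suc n)" for n and s :: real
  fix n
  have "(\<lambda>s. \<lfloor>s * real (Suc n)\<rfloor>) \<in> borel \<rightarrow>\<^sub>M count_space UNIV"
    by (rule measurable_compose[OF _ measurable_real_floor]) simp
  then have "(\<lambda>s. f (x n s)) \<in> borel_measurable borel"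
    unfolding x_def by (rule measurable_compose) simp
  then show "(\<lambda>s. f (x n s)) \<in> borel_measurable (lebesgue_on I)"
    by (intro measurable_restrict_space1 measurable_completion) simp
next
  define x where "x n s = (of_int \<lfloor>s * real (Suc n)\<rfloor> + 1) / real (Suc n)" for n and s :: real
  fix t assume "t \<in> space (lebesgue_on I)"
  then have "t \<in> I"
    by simp
  \<comment> \<open>Floor plus 1 instead of a ceiling: the sample is strictly to the right of
    \<open>t\<close> even when \<open>t\<close> is itself a grid point, as a limit along
    \<open>at_right t\<close> demands.\<close>
  have gt: "x n t > t" for n
    unfolding x_def by (simp add: pos_less_divide_eq)
  have le: "x n t \<le> t + 1 / Suc n" for n
  proof -
    have "of_int \<lfloor>t * real (Suc n)\<rfloor> + 1 \<le> t * real (Suc n) + 1"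
      by simp
    then have "x n t \<le> (t * real (Suc n) + 1) / Suc n"
      unfolding x_def by (rule divide_right_mono) simp
    also have "\<dots> = t + 1 / Suc n"
      by (simp add: add_divide_distrib)
    finally show ?thesis .
  qed
  have "(\<lambda>n. t + 1 / Suc n) \<longlonglongrightarrow> t + 0"
    by (intro tendsto_add tendsto_const LIMSEQ_Suc[OF lim_const_over_n])
  then have "(\<lambda>n. x n t) \<longlonglongrightarrow> t"
    by (intro tendsto_sandwich[OF _ _ tendsto_const, of t "\<lambda>n. x n t" sequentially "\<lambda>n. t + 1 / Suc n"])
      (use gt le in \<open>auto intro: always_eventually less_imp_le\<close>)
  then have "filterlim (\<lambda>n. x n t) (at_right t) sequentially"
    using gt by (simp add: filterlim_at less_imp_neq[THEN not_sym])
  then show "(\<lambda>n. f (x n t)) \<longlonglongrightarrow> f t"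
    by (rule filterlim_compose[OF assms[OF \<open>t \<in> I\<close>]])
qed

text \<open>Although \<open>f\<close> samples \<open>g\<close> only at the points \<open>s+\<close>,
  its left limit at \<open>t\<close> is the value of \<open>g\<close> at \<open>t-\<close>: the
  points \<open>s+\<close> tend to \<open>t-\<close> as \<open>s\<close> increases to
  \<open>t\<close>, and \<open>g\<close> is continuous there.\<close>

lemma hat_surj:
  assumes "g \<in> C_star I"
  obtains X where "X \<in> G_space I" "hat X = g"
proof -
  define f where "f t = (if t \<in> I then g (pt True t) else 0)" for t
  have lim: "(f \<longlongrightarrow> g (pt r t)) (at_side r t)" if "t \<in> I" for r t
  proof -
    have "(g \<longlongrightarrow> g (pt r t)) (atin (Istar_topology I) (pt r t))"
      using assms pt_in_Istar[OF that]
      by (auto simp: C_star_def continuous_map_atin topspace_Istar)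
    then have "((\<lambda>s. g (pt True s)) \<longlongrightarrow> g (pt r t)) (at_side r t)"
      by (simp add: tendsto_atin_pt[OF that])
    moreover have "eventually (\<lambda>s. g (pt True s) = f s) (at_side r t)"
      using eventually_at_side_mem_I[OF that] by eventually_elim (simp add: f_def)
    ultimately show ?thesis
      by (rule Lim_transform_eventually)
  qed
  have elim: "(f \<longlongrightarrow> g (pt r t)) (ess_at r t)" if "t \<in> I" for r t
    by (rule tendsto_mono[OF ess_at_le lim[OF that]])
  obtain C where C: "\<And>p. p \<in> Istar I \<Longrightarrow> cmod (g p) \<le> C"
    using assms by (auto simp: C_star_def bounded_iff)
  have "f \<in> G_fun I"
  proof (rule G_funI)
    show "f \<in> borel_measurable (lebesgue_on I)"
      by (rule borel_measurable_right_continuous)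
        (use lim[of _ True] in \<open>simp add: f_def at_side_def\<close>)
    have "AE t in lebesgue_on I. t \<in> I"
      by (simp add: AE_on_iff)
    then show "AE t in lebesgue_on I. cmod (f t) \<le> C"
      by eventually_elim (simp add: f_def C pt_in_Istar)
  qed (rule elim)
  then have X: "ae_class I f \<in> G_space I"
    by (rule ae_class_in_G_space)
  have "hat (ae_class I f) = g"
  proof (rule extensionalityI[OF hat_extensional])
    show "g \<in> extensional (Istar I)"
      using assms by (simp add: C_star_def)
    fix p assume "p \<in> Istar I"
    then obtain r t where "t \<in> I" "p = pt r t"
      by (rule Istar_cases)
    then show "hat (ae_class I f) p = g p"
      by (simp add: hat_pt[OF X] slim_ae_class[OF elim])
  qed
  with X show thesis
    by (rule that)
qed

section \<open>Derivatives and norms\<close>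

lemma has_star_deriv_at_add:
  assumes "p \<in> Istar I" "has_star_deriv_at I g p l" "has_star_deriv_at I h p m"
  shows "has_star_deriv_at I (pw_add (Istar I) g h) p (l + m)"
proof -
  obtain r t where p: "t \<in> I" "p = pt r t"
    using assms(1) by (rule Istar_cases)
  show ?thesis
    unfolding p(2) has_star_deriv_at_pt[OF p(1)]
  proof
    fix q
    have "((\<lambda>s. (g (pt q s) - g (pt r t)) / of_real (s - t) + (h (pt q s) - h (pt r t)) / of_real (s - t))
        \<longlongrightarrow> l + m) (at_side r t)"
      using assms(2,3) unfolding p(2) has_star_deriv_at_pt[OF p(1)] by (intro tendsto_add) auto
    moreover have "eventually (\<lambda>s. (g (pt q s) - g (pt r t)) / of_real (s - t)
          + (h (pt q s) - h (pt r t)) / of_real (s - t) =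
        (pw_add (Istar I) g h (pt q s) - pw_add (Istar I) g h (pt r t)) / of_real (s - t)) (at_side r t)"
      using eventually_at_side_mem_I[OF p(1)]
      by eventually_elim (simp add: pw_add_def pt_in_Istar p(1) add_divide_distrib diff_divide_distrib)
    ultimately show "((\<lambda>s. (pw_add (Istar I) g h (pt q s) - pw_add (Istar I) g h (pt r t)) / of_real (s - t))
        \<longlongrightarrow> l + m) (at_side r t)"
      by (rule Lim_transform_eventually)
  qed
qed

lemma has_star_deriv_at_scale:
  assumes "p \<in> Istar I" "has_star_deriv_at I g p l"
  shows "has_star_deriv_at I (pw_scale (Istar I) c g) p (c * l)"
proof -
  obtain r t where p: "t \<in> I" "p = pt r t"
    using assms(1) by (rule Istar_cases)
  show ?thesis
    unfolding p(2) has_star_deriv_at_pt[OF p(1)]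
  proof
    fix q
    have "((\<lambda>s. c * ((g (pt q s) - g (pt r t)) / of_real (s - t))) \<longlongrightarrow> c * l) (at_side r t)"
      using assms(2) unfolding p(2) has_star_deriv_at_pt[OF p(1)] by (intro tendsto_mult tendsto_const) auto
    moreover have "eventually (\<lambda>s. c * ((g (pt q s) - g (pt r t)) / of_real (s - t)) =
        (pw_scale (Istar I) c g (pt q s) - pw_scale (Istar I) c g (pt r t)) / of_real (s - t)) (at_side r t)"
      using eventually_at_side_mem_I[OF p(1)]
      by eventually_elim (simp add: pw_scale_def pt_in_Istar p(1) right_diff_distrib)
    ultimately show "((\<lambda>s. (pw_scale (Istar I) c g (pt q s) - pw_scale (Istar I) c g (pt r t)) / of_real (s - t))
        \<longlongrightarrow> c * l) (at_side r t)"
      by (rule Lim_transform_eventually)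
  qed
qed

lemma star_deriv_eq:
  assumes "p \<in> Istar I" "has_star_deriv_at I g p l"
  shows "star_deriv I g p = l"
proof -
  have "(THE l. has_star_deriv_at I g p l) = l"
    using assms has_star_deriv_at_unique by (intro the_equality) auto
  then show ?thesis
    using assms(1) by (simp add: star_deriv_def)
qed

lemma star_deriv_hat:
  assumes "X \<in> G_space I" "has_G_deriv I X Y"
  shows "star_deriv I (hat X) = hat Y"
proof (rule extensionalityI[of _ "Istar I"])
  show "star_deriv I (hat X) \<in> extensional (Istar I)"
    by (simp add: star_deriv_def)
  show "star_deriv I (hat X) p = hat Y p" if "p \<in> Istar I" for p
    using assms star_deriv_eq[OF that] that by (simp add: has_G_deriv_iff)
qed (rule hat_extensional)

text \<open>Uniqueness of the derivative is inherited from \<open>I_*\<close>: its transform is the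
  unique derivative there, and \<open>hat\<close> is injective.\<close>

lemma G_deriv_eq:
  assumes "X \<in> G_space I" "has_G_deriv I X Y"
  shows "G_deriv I X = Y"
  unfolding G_deriv_def
proof (rule the_equality[of "has_G_deriv I X", OF assms(2)])
  fix Z assume "has_G_deriv I X Z"
  then have "hat Z = hat Y"
    using assms star_deriv_hat by metis
  then show "Z = Y"
    using \<open>has_G_deriv I X Z\<close> assms(2) hat_inject by (auto simp: has_G_deriv_def)
qed

text \<open>\<open>G_inf\<close> only says that every iterate of a description operator has some
  derivative. The induction adds that the iterates stay in \<open>G_space I\<close>, without which
  \<open>G_deriv_eq\<close> could not identify that derivative with the next iterate.\<close>

lemma has_G_deriv_funpow:
  assumes "X \<in> G_inf I"
  shows "(G_deriv I ^^ k) X \<in> G_space I \<and> has_G_deriv I ((G_deriv I ^^ k) X) ((G_deriv I ^^ Suc k) X)"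
proof (induction k)
  case 0
  obtain Y where "has_G_deriv I ((G_deriv I ^^ 0) X) Y"
    using assms unfolding G_inf_def by blast
  moreover have "X \<in> G_space I"
    using assms by (simp add: G_inf_def)
  ultimately show ?case
    using G_deriv_eq by auto
next
  case (Suc k)
  then have G: "(G_deriv I ^^ Suc k) X \<in> G_space I"
    by (simp add: has_G_deriv_def)
  obtain Y where "has_G_deriv I ((G_deriv I ^^ Suc k) X) Y"
    using assms unfolding G_inf_def by blast
  with G show ?case
    using G_deriv_eq by auto
qed

lemma G_inf_imp_G_space: "X \<in> G_inf I \<Longrightarrow> X \<in> G_space I"
  by (simp add: G_inf_def)

lemma hat_funpow:
  assumes "X \<in> G_inf I"
  shows "(star_deriv I ^^ k) (hat X) = hat ((G_deriv I ^^ k) X)"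
proof (induction k)
  case (Suc k)
  then show ?case
    using star_deriv_hat has_G_deriv_funpow[OF assms, of k] by simp
qed simp

text \<open>The converse is the harder half. \<open>C_star_inf\<close> demands that every derivative
  lie in \<open>C_star\<close>, so \<open>hat_surj\<close> turns it into a class, and
  \<open>has_G_deriv_iff\<close> recognizes this class as a derivative. Each such step presupposes
  that the previous iterates already match.\<close>

lemma hat_in_C_star_inf_iff:
  assumes X: "X \<in> G_space I"
  shows "hat X \<in> C_star_inf I \<longleftrightarrow> X \<in> G_inf I"
proof
  assume "X \<in> G_inf I"
  note * = has_G_deriv_funpow[OF this] hat_funpow[OF this]
  have "\<exists>l. has_star_deriv_at I ((star_deriv I ^^ k) (hat X)) p l" if "p \<in> Istar I" for k p
    using *[of k] that has_G_deriv_iff by metis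
  moreover have "(star_deriv I ^^ Suc k) (hat X) \<in> C_star I" for k
    using *[of "Suc k"] hat_in_C_star by metis
  ultimately show "hat X \<in> C_star_inf I"
    using hat_in_C_star[OF X] unfolding C_star_inf_def by blast
next
  assume hat: "hat X \<in> C_star_inf I"
  have step: "\<exists>Y. has_G_deriv I ((G_deriv I ^^ k) X) Y \<and> hat Y = (star_deriv I ^^ Suc k) (hat X)"
    if "(G_deriv I ^^ k) X \<in> G_space I" "hat ((G_deriv I ^^ k) X) = (star_deriv I ^^ k) (hat X)" for k
  proof -
    have "(star_deriv I ^^ Suc k) (hat X) \<in> C_star I"
      using hat unfolding C_star_inf_def by blast
    then obtain Y where Y: "Y \<in> G_space I" "hat Y = (star_deriv I ^^ Suc k) (hat X)"
      by (rule hat_surj)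
    have "has_star_deriv_at I (hat ((G_deriv I ^^ k) X)) p (hat Y p)" if p: "p \<in> Istar I" for p
    proof -
      obtain l where "has_star_deriv_at I ((star_deriv I ^^ k) (hat X)) p l"
        using hat p unfolding C_star_inf_def by blast
      then show ?thesis
        using star_deriv_eq[OF p] Y(2) \<open>hat ((G_deriv I ^^ k) X) = _\<close> by simp
    qed
    then have "has_G_deriv I ((G_deriv I ^^ k) X) Y"
      using that(1) Y(1) by (simp add: has_G_deriv_iff)
    with Y(2) show ?thesis
      by blast
  qed
  have *: "(G_deriv I ^^ k) X \<in> G_space I \<and> hat ((G_deriv I ^^ k) X) = (star_deriv I ^^ k) (hat X)" for k
  proof (induction k)
    case (Suc k)
    then obtain Y where Y: "has_G_deriv I ((G_deriv I ^^ k) X) Y" "hat Y = (star_deriv I ^^ Suc k) (hat X)"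
      using step by blast
    then have "(G_deriv I ^^ Suc k) X = Y"
      using G_deriv_eq Suc by simp
    then show ?case
      using Y by (simp add: has_G_deriv_def)
  qed (simp add: X)
  show "X \<in> G_inf I"
    unfolding G_inf_def using X step * by blast
qed

lemma G_inf_add:
  assumes X: "X \<in> G_inf I" and Y: "Y \<in> G_inf I"
  shows "cl_add I X Y \<in> G_inf I"
    and "(G_deriv I ^^ k) (cl_add I X Y) = cl_add I ((G_deriv I ^^ k) X) ((G_deriv I ^^ k) Y)"
proof -
  let ?Z = "\<lambda>k. cl_add I ((G_deriv I ^^ k) X) ((G_deriv I ^^ k) Y)"
  \<comment> \<open>\<open>pw_add_def\<close> is instantiated so that only the derivative is
    unfolded; the function to be differentiated keeps the shape required by
    \<open>has_star_deriv_at_add\<close>.\<close>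
  have deriv: "?Z k \<in> G_space I \<and> has_G_deriv I (?Z k) (?Z (Suc k))" for k
    using has_G_deriv_funpow[OF X, of k] has_G_deriv_funpow[OF Y, of k]
      has_G_deriv_funpow[OF X, of "Suc k"] has_G_deriv_funpow[OF Y, of "Suc k"]
    by (auto simp: has_G_deriv_iff cl_add_in_G_space hat_cl_add has_star_deriv_at_add
        pw_add_def[of _ "hat ((G_deriv I ^^ Suc k) X)"] simp del: funpow.simps)
  have eq: "(G_deriv I ^^ k) (cl_add I X Y) = ?Z k" for k
  proof (induction k)
    case (Suc k)
    then show ?case
      using G_deriv_eq deriv[of k] by simp
  qed simp
  then show "(G_deriv I ^^ k) (cl_add I X Y) = ?Z k" .
  show "cl_add I X Y \<in> G_inf I"
    using deriv[of 0] deriv eq by (auto simp: G_inf_def)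
qed

lemma G_inf_scale:
  assumes X: "X \<in> G_inf I"
  shows "cl_scale I c X \<in> G_inf I"
    and "(G_deriv I ^^ k) (cl_scale I c X) = cl_scale I c ((G_deriv I ^^ k) X)"
proof -
  let ?Z = "\<lambda>k. cl_scale I c ((G_deriv I ^^ k) X)"
  have deriv: "?Z k \<in> G_space I \<and> has_G_deriv I (?Z k) (?Z (Suc k))" for k
    using has_G_deriv_funpow[OF X, of k] has_G_deriv_funpow[OF X, of "Suc k"]
    by (auto simp: has_G_deriv_iff cl_scale_in_G_space hat_cl_scale has_star_deriv_at_scale
        pw_scale_def[of _ _ "hat ((G_deriv I ^^ Suc k) X)"] simp del: funpow.simps)
  have eq: "(G_deriv I ^^ k) (cl_scale I c X) = ?Z k" for k
  proof (induction k)
    case (Suc k)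
    then show ?case
      using G_deriv_eq deriv[of k] by simp
  qed simp
  then show "(G_deriv I ^^ k) (cl_scale I c X) = ?Z k" .
  show "cl_scale I c X \<in> G_inf I"
    using deriv[of 0] deriv eq by (auto simp: G_inf_def)
qed

lemma G_inf_diff: "X \<in> G_inf I \<Longrightarrow> Y \<in> G_inf I \<Longrightarrow> cl_diff I X Y \<in> G_inf I"
  by (simp add: cl_diff_eq G_inf_add G_inf_scale G_inf_imp_G_space)

section \<open>The norms of all orders\<close>

lemma Linf_norm_le_iff:
  assumes X: "X \<in> G_space I"
  shows "Linf_norm I X \<le> c \<longleftrightarrow> (\<forall>r. \<forall>t\<in>I. cmod (slim r X t) \<le> c)"
proof -
  obtain C where "\<And>r t. t \<in> I \<Longrightarrow> cmod (slim r X t) \<le> C"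
    using bounded_slim[OF X] by blast
  then have "bdd_above ((\<lambda>p. cmod (slim (fst p) X (snd p))) ` (UNIV \<times> I))"
    by (intro bdd_aboveI[of _ C]) auto
  then show ?thesis
    using nonempty_I by (auto simp: Linf_norm_eq[OF X] cSUP_le_iff)
qed

lemma Linf_norm_eq_hat:
  assumes X: "X \<in> G_space I"
  shows "Linf_norm I X = (SUP p\<in>Istar I. cmod (hat X p))"
proof -
  have "(\<lambda>p. cmod (hat X p)) ` Istar I = (\<lambda>p. cmod (slim (fst p) X (snd p))) ` (UNIV \<times> I)"
    by (force simp: Istar_eq hat_pt[OF X] image_iff)
  then show ?thesis
    by (simp add: Linf_norm_eq[OF X])
qed

lemma G_norm_eq_star_norm:
  assumes "X \<in> G_inf I"
  shows "G_norm I k X = star_norm I k (hat X)"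
  using has_G_deriv_funpow[OF assms]
  by (simp add: G_norm_def star_norm_def hat_funpow[OF assms] Linf_norm_eq_hat)

lemma G_norm_le_iff:
  assumes "X \<in> G_inf I"
  shows "G_norm I k X \<le> c \<longleftrightarrow> (\<forall>i\<le>k. \<forall>r. \<forall>t\<in>I. cmod (slim r ((G_deriv I ^^ i) X) t) \<le> c)"
  using has_G_deriv_funpow[OF assms] by (auto simp: G_norm_def Linf_norm_le_iff)

lemma G_norm_bound:
  assumes "X \<in> G_inf I" "i \<le> k" "t \<in> I"
  shows "cmod (slim r ((G_deriv I ^^ i) X) t) \<le> G_norm I k X"
  using G_norm_le_iff[OF assms(1), of k "G_norm I k X"] assms(2,3) by blast

lemma G_norm_nonneg:
  assumes "X \<in> G_inf I"
  shows "0 \<le> G_norm I k X"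
proof -
  obtain t where "t \<in> I"
    using nonempty_I by blast
  then show ?thesis
    using G_norm_bound[OF assms, of 0 k t True] norm_ge_zero order_trans by blast
qed

lemma G_norm_mono: "X \<in> G_inf I \<Longrightarrow> j \<le> k \<Longrightarrow> G_norm I j X \<le> G_norm I k X"
  using G_norm_bound by (auto simp: G_norm_le_iff)

lemma G_norm_add_le:
  assumes X: "X \<in> G_inf I" and Y: "Y \<in> G_inf I"
  shows "G_norm I k (cl_add I X Y) \<le> G_norm I k X + G_norm I k Y"
proof -
  have "cmod (slim r ((G_deriv I ^^ i) X) t + slim r ((G_deriv I ^^ i) Y) t) \<le> G_norm I k X + G_norm I k Y"
    if "i \<le> k" "t \<in> I" for i r t
    by (rule order_trans[OF norm_triangle_ineq add_mono[OF G_norm_bound[OF X that] G_norm_bound[OF Y that]]])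
  then show ?thesis
    using has_G_deriv_funpow X Y by (simp add: G_norm_le_iff G_inf_add slim_cl_add)
qed

text \<open>Checked after \<open>hat\<close>, where it is a pointwise identity; on classes every
  operation would bring in a newly chosen representative.\<close>

lemma cl_diff_chain:
  assumes "X \<in> G_space I" "Y \<in> G_space I" "Z \<in> G_space I"
  shows "cl_diff I X Z = cl_add I (cl_diff I X Y) (cl_diff I Y Z)"
  by (rule hat_inject) (use assms in \<open>auto simp: hat_cl_diff hat_cl_add cl_diff_in_G_space
    cl_add_in_G_space pw_add_def pw_diff_def\<close>)

lemma G_norm_diff_triangle:
  assumes "X \<in> G_inf I" "Y \<in> G_inf I" "Z \<in> G_inf I"
  shows "G_norm I k (cl_diff I X Z) \<le> G_norm I k (cl_diff I X Y) + G_norm I k (cl_diff I Y Z)"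
  using G_norm_add_le[of "cl_diff I X Y" "cl_diff I Y Z" k] cl_diff_chain[of X Y Z] assms
  by (simp add: G_inf_diff G_inf_imp_G_space)

lemma G_norm_diff_self:
  assumes "X \<in> G_inf I"
  shows "G_norm I k (cl_diff I X X) = 0"
proof -
  have X: "X \<in> G_space I"
    by (rule G_inf_imp_G_space[OF assms])
  \<comment> \<open>The zero class is written as a multiple of \<open>X\<close>, so that
    \<open>G_inf_scale\<close> yields its derivatives of all orders.\<close>
  have "hat (cl_diff I X X) = hat (cl_scale I 0 X)"
    by (auto simp: hat_cl_diff hat_cl_scale X pw_diff_def pw_scale_def)
  then have eq: "cl_diff I X X = cl_scale I 0 X"
    by (rule hat_inject[rotated 2]) (simp_all add: X cl_diff_in_G_space cl_scale_in_G_space)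
  have "G_norm I k (cl_scale I 0 X) \<le> 0"
    using has_G_deriv_funpow[OF assms] assms by (simp add: G_norm_le_iff G_inf_scale slim_cl_scale)
  then show ?thesis
    unfolding eq using G_norm_nonneg[OF G_inf_scale(1)[OF assms], of k 0] by (rule antisym)
qed

section \<open>Supports\<close>

text \<open>The part of \<open>I\<close> outside the closed interval is open, so around each of its
  points the representative is 0 almost everywhere on both sides.\<close>

lemma vanishes_off_imp_star:
  assumes X: "X \<in> G_space I" and J: "J \<subseteq> {c..d}" "vanishes_off I J X"
  shows "star_vanishes_off I c d (hat X)"
  unfolding star_vanishes_off_def
proof (intro ballI impI)
  fix p assume p: "p \<in> Istar I" "base_pt I p < c \<or> base_pt I p > d"
  obtain r t where t: "t \<in> I" "p = pt r t"
    using p(1) by (rule Istar_cases)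
  have "t \<in> I \<inter> - {c..d}"
    using p(2) t by (auto simp: base_pt_pt)
  have "AE s in lebesgue. s \<in> I \<inter> - {c..d} \<longrightarrow> rep X s \<in> {0}"
    using J by (auto simp: vanishes_off_def AE_on_iff elim!: eventually_mono)
  then have "slim r X t \<in> {0}"
    by (rule tendsto_ess_at_in_closed[OF rep_tendsto_slim[OF X t(1)] closed_singleton _ _ \<open>t \<in> I \<inter> - {c..d}\<close>])
      (intro open_Int open_I open_Compl closed_atLeastAtMost)
  then show "hat X p = 0"
    by (simp add: t hat_pt X)
qed

lemma star_vanishes_off_imp:
  assumes X: "X \<in> G_space I" and "star_vanishes_off I c d (hat X)"
  shows "vanishes_off I {c..d} X"
proof -
  have "AE s in lebesgue_on I. s \<in> I"
    by (simp add: AE_on_iff)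
  with AE_rep_eq_slim[OF X, of True] show ?thesis
    unfolding vanishes_off_def
  proof eventually_elim
    case (elim s)
    show ?case
    proof
      assume "s \<notin> {c..d}"
      then have "base_pt I (pt True s) < c \<or> base_pt I (pt True s) > d"
        using elim(2) by (auto simp: base_pt_pt)
      then have "hat X (pt True s) = 0"
        using assms(2) pt_in_Istar[OF elim(2)] unfolding star_vanishes_off_def by blast
      then show "rep X s = 0"
        using elim by (simp add: hat_pt[OF X])
    qed
  qed
qed

lemma bounded_cover:
  assumes "bounded J" "closure J \<subseteq> I"
  obtains c d where "c \<in> I" "d \<in> I" "J \<subseteq> {c..d}"
proof (cases "J = {}")
  \<comment> \<open>An empty \<open>J\<close> has no extreme points; any points of \<open>I\<close>
    serve as bounds.\<close>
  case True
  with that nonempty_I show thesis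
    by blast
next
  case False
  have "compact (closure J)"
    using assms(1) by (simp add: compact_closure)
  moreover have "closure J \<noteq> {}"
    using False by simp
  ultimately obtain c d where "c \<in> closure J" "\<forall>x\<in>closure J. c \<le> x" "d \<in> closure J" "\<forall>x\<in>closure J. x \<le> d"
    using compact_attains_inf compact_attains_sup by meson
  then show thesis
    using assms(2) closure_subset[of J] by (intro that[of c d]) auto
qed

text \<open>Connectedness of \<open>I\<close> enters here. For \<open>c > d\<close> the interval is
  empty and still admissible.\<close>

lemma Icc_inner:
  assumes "c \<in> I" "d \<in> I"
  shows "{c..d} \<in> inner_intervals I"
proof -
  have "{c..d} \<subseteq> I"
    using interval_I assms unfolding is_interval_1 by (meson atLeastAtMost_iff subsetI)
  then show ?thesis
    by (simp add: inner_intervals_def is_interval_cc)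
qed

lemma R_space_iff:
  "X \<in> R_space I \<longleftrightarrow> X \<in> G_inf I \<and> (\<exists>c\<in>I. \<exists>d\<in>I. star_vanishes_off I c d (hat X))"
proof
  assume "X \<in> R_space I"
  then obtain K where K: "X \<in> G_inf I" "compact K" "K \<subseteq> I" "vanishes_off I K X"
    by (auto simp: R_space_def)
  have "bounded K" "closure K \<subseteq> I"
    using K by (simp_all add: compact_imp_bounded compact_imp_closed)
  then obtain c d where "c \<in> I" "d \<in> I" "K \<subseteq> {c..d}"
    by (rule bounded_cover)
  with K show "X \<in> G_inf I \<and> (\<exists>c\<in>I. \<exists>d\<in>I. star_vanishes_off I c d (hat X))"
    using vanishes_off_imp_star[OF G_inf_imp_G_space] by blast
next
  assume "X \<in> G_inf I \<and> (\<exists>c\<in>I. \<exists>d\<in>I. star_vanishes_off I c d (hat X))"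
  then obtain c d where *: "X \<in> G_inf I" "c \<in> I" "d \<in> I" "star_vanishes_off I c d (hat X)"
    by blast
  then have "vanishes_off I {c..d} X"
    by (intro star_vanishes_off_imp G_inf_imp_G_space)
  moreover have "{c..d} \<subseteq> I"
    using Icc_inner[OF *(2,3)] by (simp add: inner_intervals_def)
  ultimately show "X \<in> R_space I"
    using *(1) unfolding R_space_def by (blast intro: compact_Icc)
qed

lemma R_step_iff:
  assumes "c \<in> I" "d \<in> I"
  shows "X \<in> R_step I {c..d} \<longleftrightarrow> X \<in> G_inf I \<and> star_vanishes_off I c d (hat X)"
  using vanishes_off_imp_star[of X "{c..d}" c d] star_vanishes_off_imp[of X c d] G_inf_imp_G_space
  by (auto simp: R_step_def)

text \<open>The steps over compact intervals with endpoints in \<open>I\<close> are cofinal among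
  all steps; they are the ones that match the support condition of \<open>D_star\<close>.\<close>

lemma R_step_subset:
  assumes "J \<in> inner_intervals I"
  obtains c d where "c \<in> I" "d \<in> I" "R_step I J \<subseteq> R_step I {c..d}"
proof -
  have "bounded J" "closure J \<subseteq> I"
    using assms by (simp_all add: inner_intervals_def)
  then obtain c d where cd: "c \<in> I" "d \<in> I" "J \<subseteq> {c..d}"
    by (rule bounded_cover)
  have "R_step I J \<subseteq> R_step I {c..d}"
    using vanishes_off_imp_star[OF _ cd(3)] G_inf_imp_G_space cd(1,2)
    by (auto simp: R_step_iff) (auto simp: R_step_def)
  with cd show thesis
    by (intro that)
qed

lemma R_step_subset_R_space:
  assumes "J \<in> inner_intervals I"
  shows "R_step I J \<subseteq> R_space I"
proof -
  obtain c d where cd: "c \<in> I" "d \<in> I" "R_step I J \<subseteq> R_step I {c..d}"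
    using assms by (rule R_step_subset)
  have "R_step I {c..d} \<subseteq> R_space I"
    by (rule subsetI, unfold R_space_iff R_step_iff[OF cd(1,2)]) (use cd(1,2) in blast)
  with cd(3) show ?thesis
    by blast
qed

lemma star_vanishes_off_mono:
  "star_vanishes_off I c d g \<Longrightarrow> c' \<le> c \<Longrightarrow> d \<le> d' \<Longrightarrow> star_vanishes_off I c' d' g"
  by (fastforce simp: star_vanishes_off_def)

lemma R_space_common_support:
  assumes "X \<in> R_space I" "Y \<in> R_space I"
  obtains c d where "c \<in> I" "d \<in> I" "star_vanishes_off I c d (hat X)" "star_vanishes_off I c d (hat Y)"
proof -
  obtain c d c' d' where *: "c \<in> I" "d \<in> I" "star_vanishes_off I c d (hat X)"
    "c' \<in> I" "d' \<in> I" "star_vanishes_off I c' d' (hat Y)"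
    using assms by (auto simp: R_space_iff)
  show thesis
  proof (rule that[of "min c c'" "max d d'"])
    show "min c c' \<in> I" "max d d' \<in> I"
      using * by (simp_all add: min_def max_def)
  qed (use * in \<open>auto intro: star_vanishes_off_mono\<close>)
qed

lemma R_space_add:
  assumes "X \<in> R_space I" "Y \<in> R_space I"
  shows "cl_add I X Y \<in> R_space I"
proof -
  obtain c d where cd: "c \<in> I" "d \<in> I" "star_vanishes_off I c d (hat X)" "star_vanishes_off I c d (hat Y)"
    using assms by (rule R_space_common_support)
  have G: "X \<in> G_inf I" "Y \<in> G_inf I"
    using assms by (simp_all add: R_space_iff)
  have "star_vanishes_off I c d (hat (cl_add I X Y))"
    using cd(3,4) G by (auto simp: star_vanishes_off_def hat_cl_add G_inf_imp_G_space pw_add_def)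
  then show ?thesis
    using cd(1,2) G by (auto simp: R_space_iff G_inf_add)
qed

lemma R_space_scale:
  assumes "X \<in> R_space I"
  shows "cl_scale I c X \<in> R_space I"
  using assms
  by (fastforce simp: R_space_iff G_inf_scale star_vanishes_off_def hat_cl_scale G_inf_imp_G_space pw_scale_def)

lemma bij_betw_hat: "bij_betw hat (R_space I) (D_star I)"
  unfolding bij_betw_def
proof
  show "inj_on hat (R_space I)"
    by (intro inj_onI hat_inject) (simp_all add: R_space_iff G_inf_imp_G_space)
  show "hat ` R_space I = D_star I"
  proof (intro equalityI subsetI)
    fix g assume "g \<in> hat ` R_space I"
    then show "g \<in> D_star I"
      by (auto simp: R_space_iff D_star_def hat_in_C_star_inf_iff G_inf_imp_G_space)
  next
    fix g assume g: "g \<in> D_star I"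
    then have "g \<in> C_star I"
      by (simp add: D_star_def C_star_inf_def)
    then obtain X where X: "X \<in> G_space I" "hat X = g"
      by (rule hat_surj)
    then have "X \<in> R_space I"
      using g by (auto simp: R_space_iff D_star_def simp flip: hat_in_C_star_inf_iff)
    with X show "g \<in> hat ` R_space I"
      by blast
  qed
qed

end

section \<open>Continuous functionals and the isomorphism\<close>

text \<open>Transposition along a bijection merely relabels the coordinates of a product, so it is a
  homeomorphism for pointwise convergence, whatever structure \<open>A\<close> and \<open>B\<close>
  carry. Only the sets of functionals have to correspond.\<close>

lemma bij_betw_tls_isomorphic_pointwise:
  assumes h: "bij_betw h A B"
    and F: "F \<subseteq> extensional A" and F': "F' \<subseteq> extensional B"
    and FF': "\<And>M. M \<in> extensional B \<Longrightarrow> M \<in> F' \<longleftrightarrow> (\<lambda>x\<in>A. M (h x)) \<in> F"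
  shows "tls_isomorphic (pointwise_topology A F) (pw_add A) (pw_scale A)
    (pointwise_topology B F') (pw_add B) (pw_scale B)"
proof -
  define k where "k = inv_into A h"
  define \<Phi> where "\<Phi> L = (\<lambda>y\<in>B. L (k y))" for L :: "'a \<Rightarrow> complex"
  define \<Psi> where "\<Psi> M = (\<lambda>x\<in>A. M (h x))" for M :: "'b \<Rightarrow> complex"
  have k: "k y \<in> A" "h (k y) = y" if "y \<in> B" for y
    using h that by (auto simp: k_def bij_betw_def inv_into_into f_inv_into_f)
  have hk: "h x \<in> B" "k (h x) = x" if "x \<in> A" for x
    using h that by (auto simp: k_def bij_betw_def)
  have ext: "L = L'" if "L \<in> extensional S" "L' \<in> extensional S" "\<And>x. x \<in> S \<Longrightarrow> L x = L' x"
    for L L' :: "'c \<Rightarrow> complex" and S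
    using that by (rule extensionalityI)
  have \<Psi>\<Phi>: "\<Psi> (\<Phi> L) = L" if "L \<in> F" for L
    by (rule ext[of _ A]) (use F that in \<open>auto simp: \<Phi>_def \<Psi>_def hk\<close>)
  have \<Phi>\<Psi>: "\<Phi> (\<Psi> M) = M" if "M \<in> F'" for M
    by (rule ext[of _ B]) (use F' that in \<open>auto simp: \<Phi>_def \<Psi>_def k\<close>)
  have \<Phi>: "\<Phi> L \<in> F'" if "L \<in> F" for L
    using FF'[of "\<Phi> L"] \<Psi>\<Phi>[OF that] that by (simp add: \<Psi>_def \<Phi>_def)
  have \<Psi>: "\<Psi> M \<in> F" if "M \<in> F'" for M
    using FF'[of M] F' that by (auto simp: \<Psi>_def)
  have top: "topspace (pointwise_topology A F) = F" "topspace (pointwise_topology B F') = F'"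
  proof -
    have "F \<subseteq> A \<rightarrow>\<^sub>E UNIV" "F' \<subseteq> B \<rightarrow>\<^sub>E UNIV"
      using F F' by (auto simp: PiE_def)
    then show "topspace (pointwise_topology A F) = F" "topspace (pointwise_topology B F') = F'"
      by (simp_all add: pointwise_topology_def Int_absorb1)
  qed
  have eval: "continuous_map (pointwise_topology S H) euclidean (\<lambda>L. L x)" if "x \<in> S"
    for x :: 'c and S H
    unfolding pointwise_topology_def
    by (intro continuous_map_from_subtopology continuous_map_product_projection that)
  have "continuous_map (pointwise_topology A F) (pointwise_topology B F') \<Phi>"
    unfolding pointwise_topology_def[of B] continuous_map_in_subtopology continuous_map_componentwise
    using top(1) \<Phi> k(1)
    by (auto simp: \<Phi>_def intro!: eval)
  moreover have "continuous_map (pointwise_topology B F') (pointwise_topology A F) \<Psi>"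
    unfolding pointwise_topology_def[of A] continuous_map_in_subtopology continuous_map_componentwise
    using top(2) \<Psi> hk(1)
    by (auto simp: \<Psi>_def intro!: eval)
  ultimately have "homeomorphic_maps (pointwise_topology A F) (pointwise_topology B F') \<Phi> \<Psi>"
    unfolding homeomorphic_maps_def top using \<Psi>\<Phi> \<Phi>\<Psi> by blast
  then have "homeomorphic_map (pointwise_topology A F) (pointwise_topology B F') \<Phi>"
    using homeomorphic_map_maps by blast
  moreover have "\<Phi> (pw_add A L L') = pw_add B (\<Phi> L) (\<Phi> L')" for L L'
    by (rule ext[of _ B]) (auto simp: \<Phi>_def pw_add_def k)
  moreover have "\<Phi> (pw_scale A c L) = pw_scale B c (\<Phi> L)" for c L
    by (rule ext[of _ B]) (auto simp: \<Phi>_def pw_scale_def k)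
  ultimately show ?thesis
    unfolding tls_isomorphic_def by blast
qed

text \<open>Reduces sums and products of complex-valued continuous maps to
  \<open>tendsto_add\<close> and \<open>tendsto_mult\<close>.\<close>

lemma continuous_map_euclidean_iff:
  "continuous_map T euclidean f \<longleftrightarrow> (\<forall>x\<in>topspace T. (f \<longlongrightarrow> f x) (atin T x))"
  by (simp add: continuous_map_atin)

text \<open>This topology is one of those whose supremum is the inductive limit topology, which is why
  continuity on the steps suffices for continuity of \<open>L\<close>.\<close>

lemma locally_convex_pullback:
  assumes L: "linear_functional_on V vadd smul L"
    and add: "\<And>x y. x \<in> V \<Longrightarrow> y \<in> V \<Longrightarrow> vadd x y \<in> V"
    and scale: "\<And>c x. x \<in> V \<Longrightarrow> smul c x \<in> V"
  shows "locally_convex_topology V vadd smul (pullback_topology V L euclidean)"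
    (is "locally_convex_topology _ _ _ ?T")
proof -
  have L_add: "L (vadd x y) = L x + L y" if "x \<in> V" "y \<in> V" for x y
    using L that by (simp add: linear_functional_on_def)
  have L_scale: "L (smul c x) = c * L x" if "x \<in> V" for c x
    using L that by (simp add: linear_functional_on_def)
  have top: "topspace ?T = V"
    by (simp add: topspace_pullback_topology)
  have contL: "continuous_map ?T euclidean L"
    using continuous_map_pullback[of euclidean euclidean id V L] by simp
  have L1: "continuous_map (prod_topology ?T ?T) euclidean (\<lambda>z. L (fst z))"
    "continuous_map (prod_topology ?T ?T) euclidean (\<lambda>z. L (snd z))"
    "continuous_map (prod_topology (euclidean :: complex topology) ?T) euclidean (\<lambda>z. L (snd z))"
    "continuous_map (prod_topology (euclidean :: complex topology) ?T) euclidean fst"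
    using continuous_map_compose[OF continuous_map_fst contL] continuous_map_compose[OF continuous_map_snd contL]
      continuous_map_fst by (auto simp: o_def)
  have "continuous_map (prod_topology ?T ?T) euclidean (\<lambda>z. L (fst z) + L (snd z))"
    using L1(1,2) unfolding continuous_map_euclidean_iff by (auto intro!: tendsto_add)
  then have "continuous_map (prod_topology ?T ?T) euclidean (L \<circ> (\<lambda>(x, y). vadd x y))"
    by (rule continuous_map_eq) (auto simp: top L_add)
  then have "continuous_map (prod_topology ?T ?T) ?T (\<lambda>(x, y). vadd x y)"
    by (rule continuous_map_pullback') (auto simp: top add)
  moreover have "continuous_map (prod_topology euclidean ?T) euclidean (\<lambda>z. fst z * L (snd z))"
    using L1(3,4) unfolding continuous_map_euclidean_iff by (auto intro!: tendsto_mult)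
  then have "continuous_map (prod_topology euclidean ?T) euclidean (L \<circ> (\<lambda>(c, x). smul c x))"
    by (rule continuous_map_eq) (auto simp: top L_scale)
  then have "continuous_map (prod_topology euclidean ?T) ?T (\<lambda>(c, x). smul c x)"
    by (rule continuous_map_pullback') (auto simp: top scale)
  moreover have "\<exists>W. openin ?T W \<and> x \<in> W \<and> W \<subseteq> U \<and>
      (\<forall>y\<in>W. \<forall>z\<in>W. \<forall>u\<in>{0..1::real}. vadd (smul (of_real (1 - u)) y) (smul (of_real u) z) \<in> W)"
    if U: "openin ?T U" "x \<in> U" for U x
  proof -
    obtain O' where O': "open O'" "U = L -` O' \<inter> V"
      using U(1) by (auto simp: openin_pullback_topology)
    then obtain e where e: "e > 0" "ball (L x) e \<subseteq> O'"
      using U(2) by (auto elim: openE)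
    let ?W = "L -` ball (L x) e \<inter> V"
    have "vadd (smul (of_real (1 - u)) y) (smul (of_real u) z) \<in> ?W"
      if "y \<in> ?W" "z \<in> ?W" "u \<in> {0..1}" for y z u
    proof -
      have "(1 - u) *\<^sub>R L y + u *\<^sub>R L z \<in> ball (L x) e"
        using that by (intro convexD[OF convex_ball]) auto
      then show ?thesis
        using that by (simp add: L_add L_scale add scale scaleR_conv_of_real)
    qed
    moreover have "openin ?T ?W"
      by (auto simp: openin_pullback_topology)
    ultimately show ?thesis
      using U O' e by (intro exI[of _ ?W]) auto
  qed
  ultimately show ?thesis
    unfolding locally_convex_topology_def top by blast
qed

section \<open>Continuity on the inductive limit and on its steps\<close>

context open_interval
begin

lemma topspace_R_step: "topspace (R_step_topology I J) = R_step I J"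
proof -
  have "X \<in> {Y \<in> R_step I J. G_norm I 0 (cl_diff I Y X) < 1}" if "X \<in> R_step I J" for X
    using that G_norm_diff_self[of X 0] by (simp add: R_step_def)
  then show ?thesis
    unfolding R_step_topology_def topology_generated_by_topspace
    by (intro equalityI subsetI; blast intro: zero_less_one)
qed

text \<open>Phrased with preimages cut down to \<open>R_space I\<close> instead of as continuity,
  because the carrier of \<open>R_topology I\<close> is not yet known; it is found by applying this
  lemma to the zero functional.\<close>

lemma openin_R_topology_vimage:
  fixes L :: "fclass \<Rightarrow> complex"
  assumes L: "linear_functional_on (R_space I) (cl_add I) (cl_scale I) L"
    and cont: "\<And>J. J \<in> inner_intervals I \<Longrightarrow> continuous_map (R_step_topology I J) euclidean L"
    and "open U"
  shows "openin (R_topology I) (L -` U \<inter> R_space I)"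
proof -
  let ?T = "pullback_topology (R_space I) L euclidean"
  have T: "locally_convex_topology (R_space I) (cl_add I) (cl_scale I) ?T"
    by (rule locally_convex_pullback[OF L R_space_add R_space_scale])
  have steps: "\<forall>J\<in>inner_intervals I. continuous_map (R_step_topology I J) ?T (\<lambda>X. X)"
  proof (intro ballI continuous_map_pullback')
    fix J assume J: "J \<in> inner_intervals I"
    show "continuous_map (R_step_topology I J) euclidean (L \<circ> (\<lambda>X. X))"
      using cont[OF J] by (simp add: o_def)
    show "topspace (R_step_topology I J) \<subseteq> (\<lambda>X. X) -` R_space I"
      using R_step_subset_R_space[OF J] by (simp add: topspace_R_step)
  qed
  show "openin (R_topology I) (L -` U \<inter> R_space I)"
    unfolding R_topology_def
  proof (rule topology_generated_by_Basis, rule CollectI, intro exI conjI)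
    show "openin ?T (L -` U \<inter> R_space I)"
      using \<open>open U\<close> by (auto simp: openin_pullback_topology)
  qed (use T steps in auto)
qed

lemma topspace_R_topology: "topspace (R_topology I) = R_space I"
proof
  show "topspace (R_topology I) \<subseteq> R_space I"
    unfolding R_topology_def topology_generated_by_topspace
    using openin_subset by (fastforce simp: locally_convex_topology_def)
  \<comment> \<open>The zero functional pulls back to the indiscrete topology, so at least one
    topology is admissible and the generated carrier is all of \<open>R_space I\<close>.\<close>
  have "openin (R_topology I) ((\<lambda>_. 0 :: complex) -` UNIV \<inter> R_space I)"
    by (rule openin_R_topology_vimage) (simp_all add: linear_functional_on_def)
  then show "R_space I \<subseteq> topspace (R_topology I)"
    using openin_subset by fastforce
qed

text \<open>Continuity into a supremum is tested on its generators, each of which is open in a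
  topology that makes the inclusions continuous.\<close>

lemma continuous_map_R_step_R_topology:
  assumes J: "J \<in> inner_intervals I"
  shows "continuous_map (R_step_topology I J) (R_topology I) (\<lambda>X. X)"
  unfolding R_topology_def
proof (rule continuous_on_generated_topo)
  show "openin (R_step_topology I J) ((\<lambda>X. X) -` U \<inter> topspace (R_step_topology I J))"
    if "U \<in> {U. \<exists>T. locally_convex_topology (R_space I) (cl_add I) (cl_scale I) T \<and>
      (\<forall>J\<in>inner_intervals I. continuous_map (R_step_topology I J) T (\<lambda>X. X)) \<and> openin T U}" for U
    using that J unfolding continuous_map_alt by blast
  show "(\<lambda>X. X) ` topspace (R_step_topology I J) \<subseteq>
    \<Union> {U. \<exists>T. locally_convex_topology (R_space I) (cl_add I) (cl_scale I) T \<and>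
      (\<forall>J\<in>inner_intervals I. continuous_map (R_step_topology I J) T (\<lambda>X. X)) \<and> openin T U}"
    using topspace_R_topology R_step_subset_R_space[OF J]
    unfolding R_topology_def topology_generated_by_topspace by (simp add: topspace_R_step)
qed

lemma continuous_R_topology_iff:
  fixes L :: "fclass \<Rightarrow> complex"
  assumes L: "linear_functional_on (R_space I) (cl_add I) (cl_scale I) L"
  shows "continuous_map (R_topology I) euclidean L \<longleftrightarrow>
    (\<forall>J\<in>inner_intervals I. continuous_map (R_step_topology I J) euclidean L)"
proof
  assume cont: "continuous_map (R_topology I) euclidean L"
  show "\<forall>J\<in>inner_intervals I. continuous_map (R_step_topology I J) euclidean L"
    using continuous_map_compose[OF continuous_map_R_step_R_topology cont] by (simp add: o_def)
next
  assume "\<forall>J\<in>inner_intervals I. continuous_map (R_step_topology I J) euclidean L"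
  then show "continuous_map (R_topology I) euclidean L"
    using openin_R_topology_vimage[OF L] by (simp add: continuous_map_alt topspace_R_topology)
qed

text \<open>The counterpart of \<open>D_star_conv\<close> on classes: convergence inside a single
  step, not convergence in \<open>R_topology I\<close>.\<close>

definition R_conv :: "(nat \<Rightarrow> fclass) \<Rightarrow> fclass \<Rightarrow> bool" where
  "R_conv Xs X \<longleftrightarrow> (\<exists>J\<in>inner_intervals I. (\<forall>n. Xs n \<in> R_step I J) \<and> X \<in> R_step I J \<and>
    (\<forall>k. (\<lambda>n. G_norm I k (cl_diff I (Xs n) X)) \<longlonglongrightarrow> 0))"

lemma R_conv_limitin:
  assumes "\<And>n. Xs n \<in> R_step I J" "X \<in> R_step I J"
    and "\<And>k. (\<lambda>n. G_norm I k (cl_diff I (Xs n) X)) \<longlonglongrightarrow> 0"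
  shows "limitin (R_step_topology I J) Xs X sequentially"
proof -
  let ?B = "{{Y \<in> R_step I J. G_norm I k (cl_diff I Y X) < e} | X k e. X \<in> R_step I J \<and> e > 0}"
  have inf: "Y \<in> G_inf I" if "Y \<in> R_step I J" for Y
    using that by (simp add: R_step_def)
  have "eventually (\<lambda>n. Xs n \<in> U) sequentially" if U: "generate_topology_on ?B U" "X \<in> U" for U
    using U
  proof (induction U rule: generate_topology_on.induct)
    case (Int a b)
    then show ?case
      by (simp add: eventually_conj_iff)
  next
    case (UN K)
    then obtain S where S: "S \<in> K" "X \<in> S"
      by blast
    with UN have "eventually (\<lambda>n. Xs n \<in> S) sequentially"
      by blast
    then show ?case
      by (rule eventually_mono) (use S in blast)
  next
    case (Basis S)
    then obtain Z k e where S: "S = {Y \<in> R_step I J. G_norm I k (cl_diff I Y Z) < e}" "Z \<in> R_step I J" "e > 0"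
      by blast
    \<comment> \<open>The generator is centred at \<open>Z\<close> and not at \<open>X\<close>; the
      remaining slack is the radius of a ball about \<open>X\<close> contained in it.\<close>
    then have "0 < e - G_norm I k (cl_diff I X Z)"
      using Basis by simp
    with assms(3)[of k] have "eventually (\<lambda>n. G_norm I k (cl_diff I (Xs n) X) < e - G_norm I k (cl_diff I X Z)) sequentially"
      by (rule order_tendstoD)
    then show ?case
    proof eventually_elim
      case (elim n)
      have "G_norm I k (cl_diff I (Xs n) Z) < e"
        using G_norm_diff_triangle[OF inf[OF assms(1)[of n]] inf[OF assms(2)] inf[OF S(2)], of k] elim by linarith
      then show ?case
        using assms(1) by (simp add: S(1))
    qed
  qed simp
  then show ?thesis
    unfolding limitin_def topspace_R_step using assms(2)
    by (auto simp: R_step_topology_def openin_topology_generated_by_iff)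
qed

text \<open>The norms increase with their index, so the balls of radius \<open>1 / Suc n\<close> in
  the norm of order \<open>n\<close> form a countable neighbourhood base within a step.\<close>

lemma continuous_R_step_iff:
  fixes L :: "fclass \<Rightarrow> complex"
  shows
  "(\<forall>J\<in>inner_intervals I. continuous_map (R_step_topology I J) euclidean L) \<longleftrightarrow>
    (\<forall>Xs X. R_conv Xs X \<longrightarrow> (\<lambda>n. L (Xs n)) \<longlonglongrightarrow> L X)"
proof
  assume cont: "\<forall>J\<in>inner_intervals I. continuous_map (R_step_topology I J) euclidean L"
  show "\<forall>Xs X. R_conv Xs X \<longrightarrow> (\<lambda>n. L (Xs n)) \<longlonglongrightarrow> L X"
  proof (intro allI impI)
    fix Xs X assume "R_conv Xs X"
    then obtain J where J: "J \<in> inner_intervals I" "limitin (R_step_topology I J) Xs X sequentially"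
      unfolding R_conv_def using R_conv_limitin by blast
    have "limitin euclidean (L \<circ> Xs) (L X) sequentially"
      using continuous_map_limit[OF bspec[OF cont J(1)] J(2)] .
    then show "(\<lambda>n. L (Xs n)) \<longlonglongrightarrow> L X"
      by (simp add: o_def)
  qed
next
  assume seq: "\<forall>Xs X. R_conv Xs X \<longrightarrow> (\<lambda>n. L (Xs n)) \<longlonglongrightarrow> L X"
  show "\<forall>J\<in>inner_intervals I. continuous_map (R_step_topology I J) euclidean L"
  proof
    fix J assume J: "J \<in> inner_intervals I"
    have "\<exists>k e. e > 0 \<and> {Y \<in> R_step I J. G_norm I k (cl_diff I Y X) < e} \<subseteq> L -` U"
      if X: "X \<in> R_step I J" and U: "open U" "L X \<in> U" for X U
    proof (rule ccontr)
      assume *: "\<not> ?thesis"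
      \<comment> \<open>A diagonal choice: the point of index \<open>n\<close> is close to
        \<open>X\<close> in the norm of order \<open>n\<close>, hence in every lower one, so the
        sequence converges in all norms although \<open>L\<close> keeps it out of
        \<open>U\<close>.\<close>
      have "\<exists>Y. Y \<in> R_step I J \<and> G_norm I n (cl_diff I Y X) < 1 / Suc n \<and> L Y \<notin> U" for n
      proof (rule ccontr)
        assume "\<nexists>Y. Y \<in> R_step I J \<and> G_norm I n (cl_diff I Y X) < 1 / Suc n \<and> L Y \<notin> U"
        then have "1 / Suc n > (0::real) \<and> {Y \<in> R_step I J. G_norm I n (cl_diff I Y X) < 1 / Suc n} \<subseteq> L -` U"
          by auto
        then show False
          using * by blast
      qed
      then obtain Xs where Xs: "\<And>n. Xs n \<in> R_step I J" "\<And>n. G_norm I n (cl_diff I (Xs n) X) < 1 / Suc n"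
        "\<And>n. L (Xs n) \<notin> U"
        by metis
      have inf: "cl_diff I (Xs n) X \<in> G_inf I" for n
        using Xs(1) X by (simp add: R_step_def G_inf_diff)
      have "(\<lambda>n. G_norm I k (cl_diff I (Xs n) X)) \<longlonglongrightarrow> 0" for k
      proof (rule tendsto_sandwich[OF _ _ tendsto_const])
        show "(\<lambda>n. 1 / real (Suc n)) \<longlonglongrightarrow> 0"
          by (rule LIMSEQ_Suc[OF lim_const_over_n])
        show "\<forall>\<^sub>F n in sequentially. 0 \<le> G_norm I k (cl_diff I (Xs n) X)"
          by (simp add: G_norm_nonneg inf)
        show "\<forall>\<^sub>F n in sequentially. G_norm I k (cl_diff I (Xs n) X) \<le> 1 / Suc n"
          using eventually_ge_at_top[of k]
        proof eventually_elim
          case (elim n)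
          then show ?case
            using G_norm_mono[OF inf elim, of n] Xs(2)[of n] by linarith
        qed
      qed
      then have "R_conv Xs X"
        unfolding R_conv_def using J X Xs(1) by blast
      then have "(\<lambda>n. L (Xs n)) \<longlonglongrightarrow> L X"
        using seq by blast
      then have "eventually (\<lambda>n. L (Xs n) \<in> U) sequentially"
        using U by (rule topological_tendstoD)
      then show False
        using Xs(3) by simp
    qed
    note ball = this
    show "continuous_map (R_step_topology I J) euclidean L"
      unfolding continuous_map_alt topspace_R_step
    proof (intro conjI allI impI)
      fix U :: "complex set" assume "openin euclidean U"
      then have U: "open U"
        by simp
      show "openin (R_step_topology I J) (L -` U \<inter> R_step I J)"
      proof (subst openin_subopen, intro ballI)
        fix X assume X: "X \<in> L -` U \<inter> R_step I J"
        then obtain k e where ke: "e > 0" "{Y \<in> R_step I J. G_norm I k (cl_diff I Y X) < e} \<subseteq> L -` U"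
          using ball[of X U] U by blast
        let ?B = "{Y \<in> R_step I J. G_norm I k (cl_diff I Y X) < e}"
        have "openin (R_step_topology I J) ?B"
          unfolding R_step_topology_def using X ke(1) by (intro topology_generated_by_Basis) blast
        moreover have "X \<in> ?B"
          using X ke(1) G_norm_diff_self[of X k] by (simp add: R_step_def)
        ultimately show "\<exists>T. openin (R_step_topology I J) T \<and> X \<in> T \<and> T \<subseteq> L -` U \<inter> R_step I J"
          using ke(2) by (intro exI[of _ ?B]) blast
      qed
    qed simp
  qed
qed

section \<open>Matching the convergences and the duals\<close>

lemma R_conv_iff:
  assumes "\<And>n. Xs n \<in> R_space I" "X \<in> R_space I"
  shows "R_conv Xs X \<longleftrightarrow> D_star_conv I (\<lambda>n. hat (Xs n)) (hat X)"
proof -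
  have D: "hat Y \<in> D_star I" if "Y \<in> R_space I" for Y
    using bij_betw_hat that by (auto simp: bij_betw_def)
  have inf: "X \<in> G_inf I" "\<And>n. Xs n \<in> G_inf I"
    using assms by (simp_all add: R_space_iff)
  have norm: "star_norm I j (pw_diff (Istar I) (hat (Xs n)) (hat X)) = G_norm I j (cl_diff I (Xs n) X)" for j n
    using inf by (simp add: G_norm_eq_star_norm G_inf_diff hat_cl_diff G_inf_imp_G_space)
  have "(\<exists>J\<in>inner_intervals I. (\<forall>n. Xs n \<in> R_step I J) \<and> X \<in> R_step I J) \<longleftrightarrow>
    (\<exists>c\<in>I. \<exists>d\<in>I. \<forall>n. star_vanishes_off I c d (hat (Xs n)))"
  proof
    assume "\<exists>J\<in>inner_intervals I. (\<forall>n. Xs n \<in> R_step I J) \<and> X \<in> R_step I J"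
    then obtain J where J: "J \<in> inner_intervals I" "\<forall>n. Xs n \<in> R_step I J"
      by blast
    obtain c d where cd: "c \<in> I" "d \<in> I" "R_step I J \<subseteq> R_step I {c..d}"
      using J(1) by (rule R_step_subset)
    then have "Xs n \<in> R_step I {c..d}" for n
      using J(2) by blast
    then show "\<exists>c\<in>I. \<exists>d\<in>I. \<forall>n. star_vanishes_off I c d (hat (Xs n))"
      using cd(1,2) unfolding R_step_iff[OF cd(1,2)] by blast
  next
    assume "\<exists>c\<in>I. \<exists>d\<in>I. \<forall>n. star_vanishes_off I c d (hat (Xs n))"
    then obtain c d where cd: "c \<in> I" "d \<in> I" "\<And>n. star_vanishes_off I c d (hat (Xs n))"
      by blast
    \<comment> \<open>\<open>D_star_conv\<close> bounds the supports of the sequence only. The limit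
      brings its own bounds, and \<open>R_conv\<close> asks for one common step, hence the minimum
      and maximum below.\<close>
    obtain c' d' where cd': "c' \<in> I" "d' \<in> I" "star_vanishes_off I c' d' (hat X)"
      using assms(2) by (auto simp: R_space_iff)
    have I: "min c c' \<in> I" "max d d' \<in> I"
      using cd(1,2) cd'(1,2) by (simp_all add: min_def max_def)
    have "Y \<in> R_step I {min c c'..max d d'}"
      if "Y \<in> G_inf I" "star_vanishes_off I u v (hat Y)" "min c c' \<le> u" "v \<le> max d d'" for Y u v
      using star_vanishes_off_mono[OF that(2-4)] that(1) by (simp add: R_step_iff[OF I])
    then have "X \<in> R_step I {min c c'..max d d'}" "\<forall>n. Xs n \<in> R_step I {min c c'..max d d'}"
      using cd(3) cd'(3) inf by (meson min.cobounded1 min.cobounded2 max.cobounded1 max.cobounded2)+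
    then show "\<exists>J\<in>inner_intervals I. (\<forall>n. Xs n \<in> R_step I J) \<and> X \<in> R_step I J"
      using Icc_inner[OF I] by blast
  qed
  then show ?thesis
    unfolding R_conv_def D_star_conv_def norm using assms D by blast
qed

lemma D_star_dual_iff:
  assumes M: "M \<in> extensional (D_star I)"
  shows "M \<in> D_star_dual I \<longleftrightarrow> (\<lambda>X\<in>R_space I. M (hat X)) \<in> R_dual I"
proof -
  let ?L = "\<lambda>X\<in>R_space I. M (hat X)"
  have D: "D_star I = hat ` R_space I"
    using bij_betw_hat by (simp add: bij_betw_def)
  have G: "X \<in> G_space I" if "X \<in> R_space I" for X
    using that by (simp add: R_space_iff G_inf_imp_G_space)
  have lin: "linear_functional_on (R_space I) (cl_add I) (cl_scale I) ?L \<longleftrightarrow>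
      linear_functional_on (D_star I) (pw_add (Istar I)) (pw_scale (Istar I)) M"
    by (simp add: linear_functional_on_def D R_space_add R_space_scale G flip: hat_cl_add hat_cl_scale)
  have "(\<forall>Xs X. R_conv Xs X \<longrightarrow> (\<lambda>n. ?L (Xs n)) \<longlonglongrightarrow> ?L X) \<longleftrightarrow>
      (\<forall>\<phi>s \<phi>. D_star_conv I \<phi>s \<phi> \<longrightarrow> (\<lambda>n. M (\<phi>s n)) \<longlonglongrightarrow> M \<phi>)" (is "?A \<longleftrightarrow> ?B")
  proof
    assume A: ?A
    show ?B
    proof (intro allI impI)
      fix \<phi>s \<phi> assume conv: "D_star_conv I \<phi>s \<phi>"
      then have "\<forall>n. \<exists>X\<in>R_space I. \<phi>s n = hat X" "\<exists>X\<in>R_space I. \<phi> = hat X"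
        unfolding D_star_conv_def D by blast+
      then obtain Xs X where X: "\<And>n. Xs n \<in> R_space I" "\<And>n. \<phi>s n = hat (Xs n)" "X \<in> R_space I" "\<phi> = hat X"
        by metis
      then have "\<phi>s = (\<lambda>n. hat (Xs n))"
        by blast
      with conv X have "R_conv Xs X"
        by (simp add: R_conv_iff)
      with A have "(\<lambda>n. ?L (Xs n)) \<longlonglongrightarrow> ?L X"
        by blast
      then show "(\<lambda>n. M (\<phi>s n)) \<longlonglongrightarrow> M \<phi>"
        by (simp add: X)
    qed
  next
    assume B: ?B
    show ?A
    proof (intro allI impI)
      fix Xs X assume conv: "R_conv Xs X"
      then have X: "\<And>n. Xs n \<in> R_space I" "X \<in> R_space I"
        unfolding R_conv_def using R_step_subset_R_space by blast+
      then have "D_star_conv I (\<lambda>n. hat (Xs n)) (hat X)"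
        using conv by (simp add: R_conv_iff)
      with B have "(\<lambda>n. M (hat (Xs n))) \<longlonglongrightarrow> M (hat X)"
        by blast
      then show "(\<lambda>n. ?L (Xs n)) \<longlonglongrightarrow> ?L X"
        by (simp add: X)
    qed
  qed
  then show ?thesis
    unfolding D_star_dual_def R_dual_def
    using M lin continuous_R_topology_iff[of ?L] continuous_R_step_iff[of ?L] by auto
qed

lemma dual_isomorphic:
  "tls_isomorphic (R_dual_topology I) (pw_add (R_space I)) (pw_scale (R_space I))
     (D_star_dual_topology I) (pw_add (D_star I)) (pw_scale (D_star I))"
  unfolding R_dual_topology_def D_star_dual_topology_def
  by (rule bij_betw_tls_isomorphic_pointwise[OF bij_betw_hat])
    (simp_all add: D_star_dual_iff, auto simp: R_dual_def D_star_dual_def)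

end

theorem theorem2p19:
  fixes a b :: ereal and I :: "real set"
  assumes "a < b" and "I = einterval a b"
  shows "tls_isomorphic
           (R_dual_topology I) (pw_add (R_space I)) (pw_scale (R_space I))
           (D_star_dual_topology I) (pw_add (D_star I)) (pw_scale (D_star I))"
proof -
  interpret open_interval I
  proof
    show "open I"
      using assms(2) by simp
    show "is_interval I"
      unfolding is_interval_1 assms(2) einterval_def
      by (auto intro: less_le_trans) (meson ereal_less_eq(3) le_less_trans)
    show "I \<noteq> {}"
      using einterval_nonempty[OF assms(1)] by (auto simp: assms(2))
  qed
  show ?thesis
    by (rule dual_isomorphic)
qed

end
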